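(* Let $n$ be a positive integer and let $b_8(n)$ denote the number of $8$-regular partitions of $n$, i.e. the number of ways to write $n$ as an unordered sum of positive integers none of which is divisible by $8$. Then $b_8(n)$ is odd if and only if \[ 24n+7 = p^{4a+1}m^2 \] for some prime $p$, some positive integer $m$ with $p\nmid m$, and some integer $a\ge 0$. *)

theory Defs
  imports "HOL-Library.Multiset" "HOL-Computational_Algebra.Primes"
begin

definition regular_partitions :: "nat \<Rightarrow> nat \<Rightarrow> nat multiset set" where
  "regular_partitions l n =
     {P. sum_mset P = n \<and> (\<forall>k\<in>#P. 0 < k \<and> \<not> l dvd k)}"

definition num_regular_partitions :: "nat \<Rightarrow> nat \<Rightarrow> nat" where
  "num_regular_partitions l n = card (regular_partitions l n)"

(* card is a genuine count only on finite sets. *)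
lemma finite_regular_partitions: "finite (regular_partitions l n)"
proof -
  have size_le: "size P \<le> sum_mset P" if "\<forall>k\<in>#P. 0 < k" for P :: "nat multiset"
    using that by (induction P) auto
  have elem_le: "k \<le> sum_mset P" if "k \<in># P" for k and P :: "nat multiset"
    using that by (induction P) auto
  have "regular_partitions l n \<subseteq> mset ` {xs. set xs \<subseteq> {..n} \<and> length xs \<le> n}"
  proof
    fix P assume "P \<in> regular_partitions l n"
    then have P: "sum_mset P = n" "\<forall>k\<in>#P. 0 < k"
      by (auto simp: regular_partitions_def)
    obtain xs where xs: "mset xs = P"
      using ex_mset by blast
    have "set xs \<subseteq> {..n}"
      using elem_le P(1) xs by auto
    moreover have "length xs \<le> n"
      using size_le[OF P(2)] P(1) xs by auto
    ultimately show "P \<in> mset ` {xs. set xs \<subseteq> {..n} \<and> length xs \<le> n}"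
      using xs by blast
  qed
  then show ?thesis
    by (rule finite_subset) (simp add: finite_lists_length_le)
qed

end

theory Submission
  imports
    Defs
    "HOL-Library.Nat_Bijection"
    "HOL-Library.Z2"
    "HOL-Library.Discrete_Functions"
    "HOL-Computational_Algebra.Formal_Power_Series"
    "HOL-Number_Theory.Number_Theory"
begin

text \<open>
  Over \<open>GF(2)\<close> the generating function of the \<open>8\<close>-regular partitions is
  \<open>E(q\<^sup>8) / E(q) = E(q)\<^sup>7 = E(q\<^sup>4) E(q)\<^sup>3\<close> with \<open>E(q) = \<Prod>(1 - q\<^sup>k)\<close>.
  By the theorems of Euler and Gauss, \<open>E(q)\<close> and \<open>E(q)\<^sup>3\<close> are the sums of \<open>q\<^sup>j\<close> over the
  generalised pentagonal and the triangular numbers \<open>j\<close>, so the number of partitions has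
  the parity of the number of \<open>(u, v)\<close> with \<open>u\<^sup>2 + 3 v\<^sup>2 = N\<close>, where \<open>N = 24 n + 7\<close>.
  Sorting by \<open>d = gcd(u, v)\<close>, the coprime solutions for \<open>M = N / d\<^sup>2\<close> are half as many as the
  square roots of \<open>-3\<close> modulo \<open>M\<close>. There are two roots if \<open>M\<close> is a prime power; otherwise the
  Chinese remainder theorem makes their number divisible by 4. Hence the parity is that
  of the number of \<open>d\<close> for which \<open>N / d\<^sup>2\<close> is a prime power. If there is any such \<open>d\<close>, then
  \<open>N = p\<^sup>f m\<^sup>2\<close> with \<open>f\<close> odd and \<open>p\<close> not dividing \<open>m\<close>, and there are \<open>(f + 1) / 2\<close> of them.
\<close>

unbundle fps_syntax

section \<open>Finite forms of the theorems of Euler and Gauss\<close>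

lemma prod_greaterThanAtMost_head:
  fixes f :: "nat \<Rightarrow> 'a::comm_monoid_mult"
  assumes "m < n"
  shows "(\<Prod>k\<in>{m<..n}. f k) = f (Suc m) * (\<Prod>k\<in>{Suc m<..n}. f k)"
proof -
  have "{m<..n} = insert (Suc m) {Suc m<..n}"
    using assms by auto
  then show ?thesis by simp
qed

lemma prod_greaterThanAtMost_Suc:
  fixes f :: "nat \<Rightarrow> 'a::comm_monoid_mult"
  assumes "m \<le> n"
  shows "(\<Prod>k\<in>{m<..Suc n}. f k) = f (Suc n) * (\<Prod>k\<in>{m<..n}. f k)"
proof -
  have "{m<..Suc n} = insert (Suc n) {m<..n}"
    using assms by auto
  then show ?thesis by simp
qed

text \<open>Shanks's finite form of Euler's pentagonal number theorem. Its use: the summand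
  \<open>s = 0\<close> on the left is the full product, while every other one carries a power of
  \<open>q\<close> above \<open>n\<close>. Passing from \<open>n\<close> to \<open>Suc n\<close>
  changes the summand \<open>s\<close> by a term whose partial sums have a closed form.\<close>

lemma shanks_pentagonal:
  fixes q :: "'a::comm_ring_1"
  shows "(\<Sum>s\<le>n. (-1) ^ s * (\<Prod>k\<in>{s<..n}. 1 - q ^ k) * q ^ (s * n + triangle s)) =
    1 + (\<Sum>s<n. (-1) ^ Suc s * (q ^ ((Suc s)\<^sup>2 + triangle s) + q ^ ((Suc s)\<^sup>2 + triangle (Suc s))))"
proof (induction n)
  case 0
  show ?case by simp
next
  case (Suc n)
  define A where "A = (\<lambda>n s. (-1) ^ s * (\<Prod>k\<in>{s<..n}. 1 - q ^ k) * q ^ (s * n + triangle s))"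
  \<comment> \<open>\<open>- B m\<close> is the closed form of the sum of
    \<open>A (Suc n) s - A n s\<close> over \<open>s \<le> m\<close>, valid for
    \<open>m \<le> n\<close>.\<close>
  define B where "B = (\<lambda>s. (-1) ^ s * (\<Prod>k\<in>{s<..n}. 1 - q ^ k) * q ^ (Suc s * Suc n + triangle s))"
  have A_Suc: "A (Suc n) s = A n s + A n s * (q ^ s * (1 - q ^ Suc n) - 1)" if "s \<le> n" for s
    using that by (simp add: A_def prod_greaterThanAtMost_Suc power_add algebra_simps)
  have telescope: "(\<Sum>s\<le>m. A n s * (q ^ s * (1 - q ^ Suc n) - 1)) = - B m" if "m \<le> n" for m
    using that
  proof (induction m)
    case 0
    then show ?case by (simp add: A_def B_def)
  next
    case (Suc m)
    \<comment> \<open>\<open>?R\<close> is the common factor of \<open>A n (Suc m)\<close>,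
      \<open>B m\<close> and \<open>B (Suc m)\<close>; the exponents match because
      \<open>triangle (Suc m) = triangle m + Suc m\<close>.\<close>
    let ?R = "(-1) ^ m * (\<Prod>k\<in>{Suc m<..n}. 1 - q ^ k) * q ^ (Suc m * Suc n + triangle m)"
    have "A n (Suc m) = - ((-1) ^ m) * (\<Prod>k\<in>{Suc m<..n}. 1 - q ^ k) * q ^ (Suc m * n + triangle (Suc m))"
      by (simp add: A_def)
    also have "Suc m * n + triangle (Suc m) = Suc m * Suc n + triangle m"
      by simp
    finally have a: "A n (Suc m) = - ?R" by simp
    have b: "B m = (1 - q ^ Suc m) * ?R"
      using Suc.prems by (simp only: B_def prod_greaterThanAtMost_head[of m n] Suc_le_eq mult_ac)
    have "B (Suc m) = - ((-1) ^ m * (\<Prod>k\<in>{Suc m<..n}. 1 - q ^ k) * q ^ (Suc (Suc m) * Suc n + triangle (Suc m)))"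
      by (simp add: B_def)
    also have "Suc (Suc m) * Suc n + triangle (Suc m) = (Suc m * Suc n + triangle m) + Suc m + Suc n"
      by simp
    finally have c: "B (Suc m) = - (?R * q ^ Suc m * q ^ Suc n)"
      by (simp only: power_add mult_ac)
    have "(\<Sum>s\<le>Suc m. A n s * (q ^ s * (1 - q ^ Suc n) - 1)) =
        - B m + A n (Suc m) * (q ^ Suc m * (1 - q ^ Suc n) - 1)"
      using Suc by simp
    also have "\<dots> = - B (Suc m)"
      unfolding a b c by (simp only: algebra_simps) simp
    finally show ?case .
  qed
  \<comment> \<open>The two new powers on the right have different origins: one is the boundary
    value of the telescoping sum, the other the additional summand \<open>s = Suc n\<close>.\<close>
  have B_n: "B n = - ((-1) ^ Suc n * q ^ ((Suc n)\<^sup>2 + triangle n))"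
    by (simp add: B_def power2_eq_square)
  have A_n: "A (Suc n) (Suc n) = (-1) ^ Suc n * q ^ ((Suc n)\<^sup>2 + triangle (Suc n))"
    by (simp add: A_def power2_eq_square)
  have "(\<Sum>s\<le>Suc n. A (Suc n) s) = (\<Sum>s\<le>n. A (Suc n) s) + A (Suc n) (Suc n)"
    by simp
  also have "(\<Sum>s\<le>n. A (Suc n) s) = (\<Sum>s\<le>n. A n s) - B n"
    using telescope[of n] by (simp add: A_Suc sum.distrib)
  finally have "(\<Sum>s\<le>Suc n. A (Suc n) s) = (\<Sum>s\<le>n. A n s) +
      (-1) ^ Suc n * (q ^ ((Suc n)\<^sup>2 + triangle n) + q ^ ((Suc n)\<^sup>2 + triangle (Suc n)))"
    unfolding A_n B_n by (simp only: diff_minus_eq_add distrib_left add.assoc)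
  then show ?case
    using Suc.IH unfolding A_def by simp
qed

text \<open>The ratios \<open>r k\<close> stand for \<open>(1 - q^(2k)) / (1 - q^(2k-1))\<close>.\<close>

lemma shanks_triangular:
  fixes q :: "'a::idom"
  assumes r: "\<And>k. k > 0 \<Longrightarrow> r k * (1 - q ^ (2 * k - 1)) = 1 - q ^ (2 * k)"
    and nz: "\<And>k. k > 0 \<Longrightarrow> q ^ k \<noteq> 1"
  shows "(\<Sum>s<n. (\<Prod>k\<in>{s<..n}. r k) * q ^ (s * (2 * n + 1))) = (\<Sum>s<2 * n. q ^ triangle s)"
proof (induction n)
  case 0
  show ?case by simp
next
  case (Suc n)
  define A where "A = (\<lambda>n s. (\<Prod>k\<in>{s<..n}. r k) * q ^ (s * (2 * n + 1)))"
  \<comment> \<open>\<open>r (Suc n)\<close> is known only through its product with the denominator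
    \<open>d\<close>, so the whole induction step is multiplied by \<open>d\<close>, which is
    cancelled at the end.\<close>
  define d where "d = 1 - q ^ (2 * n + 1)"
  define B where "B = (\<lambda>s. (\<Prod>k\<in>{s<..n}. r k) * (1 - q ^ (2 * s + 1)) * q ^ (Suc s * (2 * n + 1)))"
  have "d \<noteq> 0"
    using nz[of "2 * n + 1"] by (simp add: d_def)
  have r_n: "r (Suc n) * d = 1 - q ^ (2 * n + 2)"
    using r[of "Suc n"] by (simp add: d_def)
  have A_Suc: "A (Suc n) s * d = A n s * (q ^ (2 * s) - q ^ (2 * n + 2 * s + 2))" if "s \<le> n" for s
  proof -
    have "s * (2 * Suc n + 1) = s * (2 * n + 1) + 2 * s" by simp
    then have "A (Suc n) s * d = (r (Suc n) * d) * A n s * q ^ (2 * s)"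
      using that by (simp only: A_def prod_greaterThanAtMost_Suc power_add mult_ac)
    also have "\<dots> = A n s * (q ^ (2 * s) - q ^ (2 * n + 2 * s + 2))"
      unfolding r_n by (simp add: algebra_simps power_add)
    finally show ?thesis .
  qed
  have telescope: "(\<Sum>s\<le>m. A (Suc n) s * d) = (\<Sum>s\<le>m. A n s) * d + B m" if "m \<le> n" for m
    using that
  proof (induction m)
    case 0
    show ?case
      using A_Suc[of 0] by (simp add: A_def B_def d_def algebra_simps power_add)
  next
    case (Suc m)
    let ?R = "(\<Prod>k\<in>{Suc m<..n}. r k) * q ^ (Suc m * (2 * n + 1))"
    have "B m = (r (Suc m) * (1 - q ^ (2 * Suc m - 1))) * ?R"
      using Suc.prems by (simp add: B_def prod_greaterThanAtMost_head[of m n] mult_ac)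
    then have b: "B m = (1 - q ^ (2 * Suc m)) * ?R"
      using r[of "Suc m"] by simp
    have a: "A n (Suc m) = ?R" by (simp add: A_def)
    have "Suc (Suc m) * (2 * n + 1) = Suc m * (2 * n + 1) + (2 * n + 1)" by simp
    then have c: "B (Suc m) = ?R * (1 - q ^ (2 * Suc m + 1)) * q ^ (2 * n + 1)"
      by (simp only: B_def power_add mult_ac)
    have e: "q ^ (2 * n + 2 * Suc m + 2) = q ^ (2 * Suc m + 1) * q ^ (2 * n + 1)"
      by (simp add: add_ac flip: power_add power_Suc)
    have "(\<Sum>s\<le>Suc m. A (Suc n) s * d) = (\<Sum>s\<le>m. A n s) * d + B m + A (Suc n) (Suc m) * d"
      using Suc by simp
    also have "A (Suc n) (Suc m) * d = ?R * (q ^ (2 * Suc m) - q ^ (2 * Suc m + 1) * q ^ (2 * n + 1))"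
      using A_Suc[OF Suc.prems] a e by simp
    also have "(\<Sum>s\<le>m. A n s) * d + B m + \<dots> = (\<Sum>s\<le>Suc m. A n s) * d + B (Suc m)"
      unfolding b c d_def using a by (simp add: algebra_simps)
    finally show ?case .
  qed
  have tri_even: "triangle (2 * n) = n * (2 * n + 1)" for n
    by (induction n) (simp_all add: algebra_simps)
  have B_n: "B n = d * q ^ triangle (Suc (2 * n))"
  proof -
    have "Suc n * (2 * n + 1) = triangle (Suc (2 * n))"
      using tri_even[of n] by simp
    then show ?thesis
      by (simp only: B_def d_def) simp
  qed
  \<comment> \<open>The sum for \<open>n\<close> ends before \<open>s = n\<close>. Hence telescoping
    up to \<open>s = n\<close> leaves two additional powers, one from \<open>A n n\<close> and one
    from \<open>B n\<close>.\<close>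
  have A_n: "A n n = q ^ triangle (2 * n)"
    by (simp add: A_def tri_even)
  have "(\<Sum>s<Suc n. A (Suc n) s) * d = ((\<Sum>s<n. A n s) + A n n) * d + B n"
    using telescope[of n] by (simp add: sum_distrib_right distrib_right flip: lessThan_Suc_atMost)
  also have "\<dots> = ((\<Sum>s<n. A n s) + q ^ triangle (2 * n) + q ^ triangle (Suc (2 * n))) * d"
    unfolding A_n B_n by (simp add: algebra_simps)
  finally have "(\<Sum>s<Suc n. A (Suc n) s) =
      (\<Sum>s<n. A n s) + q ^ triangle (2 * n) + q ^ triangle (Suc (2 * n))"
    using \<open>d \<noteq> 0\<close> by simp
  then show ?case
    using Suc.IH unfolding A_def by simp
qed

section \<open>Congruences of power series modulo a power of X\<close>

lemma fps_X_power_dvd_iff: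
  fixes f :: "'a::comm_ring_1 fps"
  shows "fps_X ^ n dvd f \<longleftrightarrow> (\<forall>i<n. f $ i = 0)"
proof
  assume "fps_X ^ n dvd f"
  then show "\<forall>i<n. f $ i = 0"
    by (auto simp: fps_X_power_mult_nth elim!: dvdE)
next
  assume "\<forall>i<n. f $ i = 0"
  then have "f = fps_X ^ n * fps_shift n f"
    by (auto simp: fps_eq_iff fps_X_power_mult_nth)
  then show "fps_X ^ n dvd f"
    by (metis dvd_triv_left)
qed

lemma dvd_diff_mult:
  fixes a :: "'a::comm_ring_1"
  assumes "c dvd a - b" "c dvd a' - b'"
  shows "c dvd a * a' - b * b'"
proof -
  have "a * a' - b * b' = a * (a' - b') + (a - b) * b'"
    by (simp add: algebra_simps)
  then show ?thesis
    using assms by simp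
qed

lemma dvd_diff_power:
  fixes a :: "'a::comm_ring_1"
  assumes "c dvd a - b"
  shows "c dvd a ^ n - b ^ n"
  by (induction n) (simp_all add: dvd_diff_mult assms)

lemma dvd_diff_trans:
  fixes a :: "'a::comm_ring_1"
  assumes "c dvd a - b" "c dvd b - d"
  shows "c dvd a - d"
  using dvd_add[OF assms] by simp

text \<open>A truncation of Euler's product. That two series agree up to the coefficient of index
  \<open>n\<close> is expressed by \<open>fps_X ^ Suc n\<close> dividing their difference, so finite
  products suffice and no limits occur.\<close>

definition euler_prod :: "nat \<Rightarrow> 'a::comm_ring_1 fps" where
  "euler_prod n = (\<Prod>k\<in>{0<..n}. 1 - fps_X ^ k)"

lemma euler_prod_nth_0 [simp]: "euler_prod n $ 0 = 1"
  unfolding euler_prod_def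
  by (induction n) (simp_all add: prod_greaterThanAtMost_Suc)

lemma euler_prod_stable:
  assumes "m \<le> n"
  shows "fps_X ^ Suc m dvd (euler_prod n - euler_prod m :: 'a::comm_ring_1 fps)"
  using assms
proof (induction n rule: dec_induct)
  case base
  show ?case by simp
next
  case (step n)
  have "euler_prod (Suc n) - euler_prod m =
      (euler_prod n - euler_prod m) - fps_X ^ Suc n * (euler_prod n :: 'a fps)"
    by (simp add: euler_prod_def prod_greaterThanAtMost_Suc algebra_simps)
  moreover have "(fps_X :: 'a fps) ^ Suc m dvd fps_X ^ Suc n"
    using step by (intro le_imp_power_dvd) simp
  ultimately show ?case
    using step.IH by (metis dvd_diff dvd_mult2)
qed

lemma euler_prod_pentagonal:
  "fps_X ^ Suc n dvd (euler_prod n -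
    (1 + (\<Sum>s<n. (-1) ^ Suc s * (fps_X ^ ((Suc s)\<^sup>2 + triangle s) + fps_X ^ ((Suc s)\<^sup>2 + triangle (Suc s))))
      :: 'a::comm_ring_1 fps))"
proof -
  define A :: "nat \<Rightarrow> 'a fps" where
    "A = (\<lambda>s. (-1) ^ s * (\<Prod>k\<in>{s<..n}. 1 - fps_X ^ k) * fps_X ^ (s * n + triangle s))"
  \<comment> \<open>The exponent in \<open>A (Suc s)\<close> is at least \<open>n + 1\<close>, so
    only \<open>A 0 = euler_prod n\<close> survives modulo \<open>fps_X ^ Suc n\<close>.\<close>
  have "fps_X ^ Suc n dvd A (Suc s)" for s
    unfolding A_def by (intro dvd_mult le_imp_power_dvd) simp
  then have "fps_X ^ Suc n dvd (\<Sum>s<n. A (Suc s))"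
    by (intro dvd_sum)
  moreover have "(\<Sum>s\<le>n. A s) = euler_prod n + (\<Sum>s<n. A (Suc s))"
    by (subst sum.atMost_shift) (simp add: A_def euler_prod_def)
  ultimately have "fps_X ^ Suc n dvd euler_prod n - (\<Sum>s\<le>n. A s)"
    by simp
  then show ?thesis
    using shanks_pentagonal[of "fps_X :: 'a fps" n] unfolding A_def by simp
qed

lemma fps_X_power_neq_1: "k > 0 \<Longrightarrow> fps_X ^ k \<noteq> (1 :: 'a::comm_ring_1 fps)"
  by (auto simp: fps_eq_iff intro!: exI[of _ 0])

lemma euler_prod_double:
  "euler_prod (2 * n) = (\<Prod>k\<in>{0<..n}. 1 - fps_X ^ (2 * k - 1)) * (\<Prod>k\<in>{0<..n}. 1 - fps_X ^ (2 * k))"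
proof (induction n)
  case (Suc n)
  then show ?case
    by (simp add: euler_prod_def prod_greaterThanAtMost_Suc mult_ac)
qed (simp add: euler_prod_def)

text \<open>Gauss's theorem on triangular numbers with denominators cleared: it equates the quotient
  of the even-index product by the odd-index product with the triangular series, and
  \<open>euler_prod (2 * n)\<close> is the product of these two. The assumption \<open>n > 0\<close>
  puts \<open>s = 0\<close> into the range \<open>s < n\<close>; its term is the only one that
  survives modulo \<open>fps_X ^ Suc n\<close>.\<close>

lemma euler_prod_triangular:
  assumes "n > 0"
  shows "fps_X ^ Suc n dvd ((\<Prod>k\<in>{0<..n}. 1 - fps_X ^ (2 * k))\<^sup>2 -
    euler_prod (2 * n) * (\<Sum>s<2 * n. fps_X ^ triangle s) :: 'a::field fps)"
proof -
  define r :: "nat \<Rightarrow> 'a fps" where "r = (\<lambda>k. (1 - fps_X ^ (2 * k)) * inverse (1 - fps_X ^ (2 * k - 1)))"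
  define A where "A = (\<lambda>s. (\<Prod>k\<in>{s<..n}. r k) * fps_X ^ (s * (2 * n + 1)))"
  have r: "r k * (1 - fps_X ^ (2 * k - 1)) = 1 - fps_X ^ (2 * k)" if "k > 0" for k
  proof -
    have "inverse (1 - fps_X ^ (2 * k - 1)) * (1 - fps_X ^ (2 * k - 1) :: 'a fps) = 1"
      using that by (intro inverse_mult_eq_1) simp
    then show ?thesis
      by (simp add: r_def mult.assoc)
  qed
  have "fps_X ^ Suc n dvd A (Suc s)" for s
    unfolding A_def by (intro dvd_mult le_imp_power_dvd) simp
  then have "fps_X ^ Suc n dvd (\<Sum>s<n - 1. A (Suc s))"
    by (intro dvd_sum)
  moreover have "(\<Sum>s<n. A s) = A 0 + (\<Sum>s<n - 1. A (Suc s))"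
    using assms sum.lessThan_Suc_shift[of A "n - 1"] by simp
  ultimately have "fps_X ^ Suc n dvd A 0 - (\<Sum>s<n. A s)"
    by simp
  also have "(\<Sum>s<n. A s) = (\<Sum>s<2 * n. fps_X ^ triangle s)"
    unfolding A_def by (rule shanks_triangular[OF r fps_X_power_neq_1])
  finally have "fps_X ^ Suc n dvd A 0 - (\<Sum>s<2 * n. fps_X ^ triangle s)" .
  then have "fps_X ^ Suc n dvd euler_prod (2 * n) * (A 0 - (\<Sum>s<2 * n. fps_X ^ triangle s))"
    by (rule dvd_mult)
  moreover have A_0: "A 0 * (\<Prod>k\<in>{0<..n}. 1 - fps_X ^ (2 * k - 1)) = (\<Prod>k\<in>{0<..n}. 1 - fps_X ^ (2 * k))"
    unfolding A_def using r by (simp flip: prod.distrib)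
  have "euler_prod (2 * n) * A 0 =
      (A 0 * (\<Prod>k\<in>{0<..n}. 1 - fps_X ^ (2 * k - 1))) * (\<Prod>k\<in>{0<..n}. 1 - fps_X ^ (2 * k))"
    unfolding euler_prod_double by (simp only: mult_ac)
  then have "euler_prod (2 * n) * A 0 = (\<Prod>k\<in>{0<..n}. 1 - fps_X ^ (2 * k))\<^sup>2"
    unfolding A_0 by (simp only: power2_eq_square)
  ultimately show ?thesis
    by (simp add: right_diff_distrib)
qed

lemma fps_X_power_dvd_cancel:
  fixes f :: "'a::field fps"
  assumes "fps_X ^ n dvd u * f" "u $ 0 \<noteq> 0"
  shows "fps_X ^ n dvd f"
  using assms by (simp add: dvd_mult_unit_iff')

section \<open>Regular partitions modulo 2\<close>

definition parts_fps :: "nat set \<Rightarrow> 'a::comm_ring_1 fps" where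
  "parts_fps A = Abs_fps (\<lambda>n. of_nat (card {P. set_mset P \<subseteq> A \<and> sum_mset P = n}))"

lemma finite_partitions_into:
  assumes "0 \<notin> A"
  shows "finite {P. set_mset P \<subseteq> A \<and> sum_mset P = (n::nat)}"
  by (rule finite_subset[OF _ finite_regular_partitions[of 0 n]])
     (use assms in \<open>auto simp: regular_partitions_def intro!: gr0I\<close>)

text \<open>A partition with parts in \<open>insert k A\<close> either avoids \<open>k\<close> or
  arises from exactly one such partition of \<open>n - k\<close> by adding a part \<open>k\<close>.
  Hence the new series \<open>F\<close> and the old series \<open>G\<close> satisfy
  \<open>F = G + fps_X ^ k * F\<close>.\<close>

lemma parts_fps_insert:
  assumes "0 \<notin> A" "k \<notin> A" "k > 0"
  shows "parts_fps (insert k A) * (1 - fps_X ^ k) = (parts_fps A :: 'a::comm_ring_1 fps)"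
proof -
  define S where "S = (\<lambda>A n. {P. set_mset P \<subseteq> A \<and> sum_mset P = (n::nat)})"
  have nth: "parts_fps B $ n = (of_nat (card (S B n)) :: 'a)" for B n
    by (simp add: parts_fps_def S_def)
  have fin: "finite (S A n)" "finite (S (insert k A) n)" for n
    using assms by (auto simp: S_def intro!: finite_partitions_into)
  have below: "S (insert k A) n = S A n" if "n < k" for n
  proof -
    have "k \<notin># P" if "sum_mset P = n" for P
      using \<open>n < k\<close> that by (auto dest!: multi_member_split)
    then show ?thesis
      unfolding S_def by blast
  qed
  have above: "card (S (insert k A) n) = card (S A n) + card (S (insert k A) (n - k))" if "n \<ge> k" for n
  proof -
    have "S (insert k A) n = S A n \<union> add_mset k ` S (insert k A) (n - k)"
    proof (intro equalityI subsetI)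
      fix P assume P: "P \<in> S (insert k A) n"
      show "P \<in> S A n \<union> add_mset k ` S (insert k A) (n - k)"
      proof (cases "k \<in># P")
        case True
        then obtain Q where "P = add_mset k Q"
          by (blast dest: multi_member_split)
        then show ?thesis
          using P by (auto simp: S_def)
      next
        case False
        then show ?thesis
          using P by (auto simp: S_def)
      qed
    next
      fix P assume "P \<in> S A n \<union> add_mset k ` S (insert k A) (n - k)"
      then show "P \<in> S (insert k A) n"
        using that by (auto simp: S_def)
    qed
    moreover have "k \<notin># P" if "P \<in> S A n" for P
      using that \<open>k \<notin> A\<close> unfolding S_def by blast
    then have "S A n \<inter> add_mset k ` S (insert k A) (n - k) = {}"
      by force
    moreover have "card (add_mset k ` S (insert k A) (n - k)) = card (S (insert k A) (n - k))"
      by (intro card_image) (simp add: inj_on_def)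
    ultimately show ?thesis
      using fin by (simp add: card_Un_disjoint)
  qed
  have "parts_fps (insert k A) = parts_fps A + fps_X ^ k * (parts_fps (insert k A) :: 'a fps)"
    using below above by (simp add: fps_eq_iff nth fps_X_power_mult_nth)
  then show ?thesis
    by (simp add: algebra_simps)
qed

lemma parts_fps_mult_prod:
  assumes "finite A" "0 \<notin> A"
  shows "parts_fps A * (\<Prod>k\<in>A. 1 - fps_X ^ k) = (1 :: 'a::comm_ring_1 fps)"
  using assms
proof (induction A rule: finite_induct)
  case empty
  have "{P. P = {#} \<and> sum_mset P = n} = (if n = 0 then {{#}} else {})" for n :: nat
    by auto
  then show ?case
    by (simp add: parts_fps_def fps_eq_iff)
next
  case (insert k A)
  then show ?case
    using parts_fps_insert[of A k, where 'a = 'a]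
    by (simp flip: mult.assoc)
qed

section \<open>Power series over GF(2) and the seventh power of Euler's product\<close>

lemma bit_fps_uminus [simp]: "- f = (f :: bit fps)"
  by (simp add: fps_eq_iff)

lemma bit_fps_diff [simp]: "f - g = (f + g :: bit fps)"
  by (metis bit_fps_uminus diff_conv_add_uminus)

lemma bit_fps_add_square: "(f + g)\<^sup>2 = f\<^sup>2 + (g\<^sup>2 :: bit fps)"
proof -
  have "f * g + f * g = 0"
    by (metis bit_fps_diff diff_self)
  then show ?thesis
    by (simp add: power2_eq_square algebra_simps)
qed

lemma bit_fps_sum_square: "(\<Sum>x\<in>A. f x)\<^sup>2 = (\<Sum>x\<in>A. (f x)\<^sup>2 :: bit fps)"
  by (induction A rule: infinite_finite_induct) (simp_all add: bit_fps_add_square)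

lemma bit_fps_sum_power4: "(\<Sum>x\<in>A. f x) ^ 4 = (\<Sum>x\<in>A. f x ^ 4 :: bit fps)"
proof -
  have eq: "g ^ 4 = (g\<^sup>2)\<^sup>2" for g :: "bit fps"
    by (simp flip: power_mult)
  show ?thesis
    by (simp only: eq bit_fps_sum_square)
qed

lemma bit_fps_one_plus_X_power8: "1 + fps_X ^ (8 * k) = (1 + fps_X ^ k :: bit fps) ^ 8"
proof -
  have eq: "g ^ 8 = ((g\<^sup>2)\<^sup>2)\<^sup>2" for g :: "bit fps"
    by (simp flip: power_mult)
  show ?thesis
    unfolding eq bit_fps_add_square by (simp add: mult.commute flip: power_mult)
qed

lemma of_nat_bit: "(of_nat n :: bit) = of_bool (odd n)"
  by (induction n) auto

text \<open>The bound \<open>8 * n\<close> makes the excluded parts exactly the multiples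
  \<open>8 * k\<close> with \<open>0 < k \<le> n\<close>. By the Frobenius map their product is
  \<open>euler_prod n ^ 8\<close>, so the series times \<open>euler_prod (8 * n)\<close> equals that
  power. Replacing \<open>euler_prod (8 * n)\<close> by \<open>euler_prod n\<close> and cancelling
  this unit leaves the seventh power.\<close>

lemma regular_partitions_fps:
  "fps_X ^ Suc n dvd (parts_fps {k\<in>{0<..8 * n}. \<not> 8 dvd k} - euler_prod n ^ 7 :: bit fps)"
proof -
  define A where "A = {k\<in>{0<..8 * n}. \<not> 8 dvd k}"
  define B where "B = {k\<in>{0<..8 * n}. 8 dvd k}"
  define F :: "bit fps" where "F = parts_fps A"
  have "B = (*) 8 ` {0<..n}"
    by (auto simp: B_def elim!: dvdE)
  then have "(\<Prod>k\<in>B. 1 - fps_X ^ k) = (\<Prod>k\<in>{0<..n}. 1 - fps_X ^ (8 * k) :: bit fps)"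
    by (simp add: prod.reindex inj_on_def)
  also have "\<dots> = euler_prod n ^ 8"
    by (simp add: euler_prod_def bit_fps_one_plus_X_power8 prod_power_distrib)
  finally have B: "(\<Prod>k\<in>B. 1 - fps_X ^ k) = (euler_prod n ^ 8 :: bit fps)" .
  have "{0<..8 * n} = A \<union> B" "A \<inter> B = {}" "finite A" "finite B"
    by (auto simp: A_def B_def)
  then have "euler_prod (8 * n) = (\<Prod>k\<in>A. 1 - fps_X ^ k) * (euler_prod n ^ 8 :: bit fps)"
    unfolding B[symmetric] by (simp add: euler_prod_def prod.union_disjoint)
  then have "F * euler_prod (8 * n) = F * (\<Prod>k\<in>A. 1 - fps_X ^ k) * euler_prod n ^ 8"
    by (simp add: mult.assoc)
  also have "F * (\<Prod>k\<in>A. 1 - fps_X ^ k) = 1"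
    unfolding F_def by (rule parts_fps_mult_prod) (auto simp: A_def)
  finally have eq: "F * euler_prod (8 * n) = euler_prod n ^ 8"
    by simp
  have "fps_X ^ Suc n dvd F * euler_prod (8 * n) - F * (euler_prod n :: bit fps)"
    unfolding right_diff_distrib[symmetric] by (intro dvd_mult euler_prod_stable) simp
  then have "fps_X ^ Suc n dvd euler_prod n ^ 8 - F * euler_prod n"
    unfolding eq .
  also have "euler_prod n ^ 8 - F * euler_prod n = euler_prod n * (F - euler_prod n ^ 7)"
    by (simp add: algebra_simps flip: power_Suc)
  finally show ?thesis
    unfolding F_def A_def by (rule fps_X_power_dvd_cancel) simp
qed

text \<open>Modulo 2 the product over even exponents is the square of Euler's product, so Gauss's
  theorem reads \<open>E ^ 4 = E * T\<close> with \<open>T\<close> the triangular series, and the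
  unit \<open>E\<close> cancels.\<close>

lemma euler_prod_cube_triangular:
  assumes "n > 0"
  shows "fps_X ^ Suc n dvd (euler_prod n ^ 3 - (\<Sum>s<2 * n. fps_X ^ triangle s) :: bit fps)"
proof -
  define T :: "bit fps" where "T = (\<Sum>s<2 * n. fps_X ^ triangle s)"
  have "(\<Prod>k\<in>{0<..n}. 1 - fps_X ^ (2 * k)) = (euler_prod n :: bit fps)\<^sup>2"
    unfolding euler_prod_def prod_power_distrib
    by (simp add: bit_fps_add_square mult.commute flip: power_mult)
  then have "fps_X ^ Suc n dvd ((euler_prod n)\<^sup>2)\<^sup>2 - euler_prod (2 * n) * T"
    using euler_prod_triangular[OF assms, where 'a = bit] by (simp only: T_def)
  moreover have "fps_X ^ Suc n dvd euler_prod (2 * n) * T - euler_prod n * T"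
    unfolding left_diff_distrib[symmetric] by (intro dvd_mult2 euler_prod_stable) simp
  ultimately have "fps_X ^ Suc n dvd ((euler_prod n)\<^sup>2)\<^sup>2 - euler_prod n * T"
    by (rule dvd_diff_trans)
  also have "((euler_prod n)\<^sup>2)\<^sup>2 - euler_prod n * T = euler_prod n * (euler_prod n ^ 3 - T)"
    by (simp add: algebra_simps numeral_eq_Suc)
  finally show ?thesis
    unfolding T_def by (rule fps_X_power_dvd_cancel) simp
qed

section \<open>Pentagonal numbers, triangular numbers and the form u^2 + 3 v^2\<close>

definition pentagonal :: "int \<Rightarrow> nat" where
  "pentagonal s = nat (s * (3 * s + 1) div 2)"

text \<open>Completing the square. Since \<open>s * (3 * s + 1)\<close> is even and nonnegative for
  every integer \<open>s\<close>, neither \<open>div\<close> nor \<open>nat\<close> in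
  \<open>pentagonal\<close> loses anything.\<close>

lemma pentagonal_square: "24 * int (pentagonal s) + 1 = (6 * s + 1)\<^sup>2"
proof -
  have "even (s * (3 * s + 1))" by simp
  then obtain t where t: "s * (3 * s + 1) = 2 * t" by (elim evenE)
  have "s * (3 * s + 1) \<ge> 0"
    by (cases "s \<ge> 0") (auto intro!: mult_nonneg_nonneg mult_nonpos_nonpos)
  then have "int (pentagonal s) = t"
    using t by (simp add: pentagonal_def)
  moreover have "(6 * s + 1)\<^sup>2 = 12 * (s * (3 * s + 1)) + 1"
    by (simp add: power2_eq_square algebra_simps)
  ultimately show ?thesis
    using t by simp
qed

lemma triangle_square: "8 * triangle k + 1 = (2 * k + 1)\<^sup>2"
  by (induction k) (simp_all add: power2_eq_square)

text \<open>This and the next lemma recognise the two families of exponents in Shanks's identity as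
  the pentagonal numbers of positive and of negative index. Both compare squares after multiplying
  by 24 and adding 1.\<close>

lemma pentagonal_of_nat: "pentagonal (int s) = s\<^sup>2 + triangle s"
proof -
  have "24 * int (pentagonal (int s)) + 1 = 24 * int (s\<^sup>2 + triangle s) + 1"
    unfolding pentagonal_square using arg_cong[OF triangle_square[of s], of int]
    by (simp add: power2_eq_square algebra_simps)
  then show ?thesis
    unfolding add_right_cancel mult_cancel_left of_nat_eq_iff by simp
qed

lemma pentagonal_uminus_Suc: "pentagonal (- int (Suc s)) = (Suc s)\<^sup>2 + triangle s"
proof -
  have "24 * int (pentagonal (- int (Suc s))) + 1 = 24 * int ((Suc s)\<^sup>2 + triangle s) + 1"
    unfolding pentagonal_square using arg_cong[OF triangle_square[of s], of int]
    by (simp add: power2_eq_square algebra_simps)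
  then show ?thesis
    unfolding add_right_cancel mult_cancel_left of_nat_eq_iff by simp
qed

lemma euler_prod_pentagonal_bit:
  "fps_X ^ Suc n dvd (euler_prod n - (\<Sum>s\<in>{-int n..int n}. fps_X ^ pentagonal s) :: bit fps)"
proof -
  have "1 + (\<Sum>s<n. (-1) ^ Suc s * (fps_X ^ ((Suc s)\<^sup>2 + triangle s) + fps_X ^ ((Suc s)\<^sup>2 + triangle (Suc s)))) =
      (\<Sum>s\<in>{-int n..int n}. fps_X ^ pentagonal s :: bit fps)"
  proof (induction n)
    case 0
    show ?case by (simp add: pentagonal_def)
  next
    case (Suc n)
    have "{- int (Suc n)..int (Suc n)} = insert (- int (Suc n)) (insert (int (Suc n)) {-int n..int n})"
      by auto
    then have "(\<Sum>s\<in>{- int (Suc n)..int (Suc n)}. fps_X ^ pentagonal s :: bit fps) =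
        fps_X ^ pentagonal (- int (Suc n)) + (fps_X ^ pentagonal (int (Suc n)) +
        (\<Sum>s\<in>{-int n..int n}. fps_X ^ pentagonal s))"
      by (simp del: of_nat_Suc)
    then show ?case
      unfolding pentagonal_uminus_Suc pentagonal_of_nat Suc.IH[symmetric]
      by (simp add: add_ac)
  qed
  then show ?thesis
    using euler_prod_pentagonal[of n, where 'a = bit] by metis
qed

lemma num_regular_partitions_8_parity:
  assumes "n > 0"
  shows "odd (num_regular_partitions 8 n) \<longleftrightarrow>
    odd (card {(s, k). n = 4 * pentagonal s + triangle k})"
proof -
  define I where "I = {-int n..int n} \<times> {..<2 * n}"
  define A where "A = {k\<in>{0<..8 * n}. \<not> 8 dvd k}"
  have fin: "finite I" by (simp add: I_def)
  have "k \<le> n" if "k \<in># P" "sum_mset P = n" for k and P :: "nat multiset"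
    using that by (auto dest!: multi_member_split)
  then have "{P. set_mset P \<subseteq> A \<and> sum_mset P = n} = regular_partitions 8 n"
    unfolding A_def regular_partitions_def by fastforce
  then have coeff: "parts_fps A $ n = (of_nat (num_regular_partitions 8 n) :: bit)"
    by (simp add: parts_fps_def num_regular_partitions_def)
  have pow4: "(fps_X ^ m) ^ 4 = (fps_X ^ (4 * m) :: bit fps)" for m
    by (simp add: mult.commute flip: power_mult)
  \<comment> \<open>The seventh power is split as 4 + 3: in characteristic 2 the fourth power merely
    multiplies all exponents by 4, and the cube is the triangular series.\<close>
  have "fps_X ^ Suc n dvd (euler_prod n ^ 4 * euler_prod n ^ 3 -
      (\<Sum>s\<in>{-int n..int n}. fps_X ^ pentagonal s) ^ 4 * (\<Sum>s<2 * n. fps_X ^ triangle s) :: bit fps)"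
    by (intro dvd_diff_mult dvd_diff_power euler_prod_pentagonal_bit euler_prod_cube_triangular assms)
  then have "fps_X ^ Suc n dvd (parts_fps A -
      (\<Sum>s\<in>{-int n..int n}. fps_X ^ pentagonal s) ^ 4 * (\<Sum>s<2 * n. fps_X ^ triangle s) :: bit fps)"
    by (intro dvd_diff_trans[OF regular_partitions_fps[of n, folded A_def]]) (simp flip: power_add)
  also have "(\<Sum>s\<in>{-int n..int n}. fps_X ^ pentagonal s) ^ 4 * (\<Sum>s<2 * n. fps_X ^ triangle s) =
      (\<Sum>(s, k)\<in>I. fps_X ^ (4 * pentagonal s + triangle k) :: bit fps)"
    by (simp add: I_def bit_fps_sum_power4 sum_product sum.cartesian_product power_add pow4)
  finally have "(parts_fps A - (\<Sum>(s, k)\<in>I. fps_X ^ (4 * pentagonal s + triangle k)) :: bit fps) $ n = 0"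
    by (simp only: fps_X_power_dvd_iff lessI)
  then have "of_nat (num_regular_partitions 8 n) =
      (\<Sum>(s, k)\<in>I. fps_X ^ (4 * pentagonal s + triangle k) :: bit fps) $ n"
    unfolding fps_sub_nth coeff by (simp only: right_minus_eq)
  also have "\<dots> = (\<Sum>(s, k)\<in>I. of_bool (n = 4 * pentagonal s + triangle k))"
    by (auto simp: fps_sum_nth intro!: sum.cong)
  also have "\<dots> = of_nat (card {x\<in>I. case x of (s, k) \<Rightarrow> n = 4 * pentagonal s + triangle k})"
    using fin by (simp add: case_prod_unfold sum_of_bool_eq Int_def)
  \<comment> \<open>The box \<open>I\<close> misses no solution: \<open>\<bar>s\<bar>\<close> is at
    most twice its pentagonal number, and \<open>k \<le> triangle k\<close>.\<close>
  also have "{x\<in>I. case x of (s, k) \<Rightarrow> n = 4 * pentagonal s + triangle k} =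
      {(s, k). n = 4 * pentagonal s + triangle k}"
  proof -
    have "\<bar>s\<bar> \<le> int n \<and> k < 2 * n" if "n = 4 * pentagonal s + triangle k" for s k
    proof
      have "3 * s + 1 \<noteq> 0" by presburger
      then have "\<bar>s\<bar> * 1 \<le> \<bar>s\<bar> * \<bar>3 * s + 1\<bar>"
        by (intro mult_left_mono) linarith+
      then have "\<bar>s\<bar> \<le> \<bar>s * (3 * s + 1)\<bar>"
        by (simp add: abs_mult)
      moreover have "s * (3 * s + 1) = 2 * int (pentagonal s)"
        using pentagonal_square[of s] by (simp add: power2_eq_square algebra_simps)
      ultimately show "\<bar>s\<bar> \<le> int n"
        using that by linarith
      have "k \<le> triangle k" by (induction k) auto
      then show "k < 2 * n"
        using that assms by linarith
    qed
    then show ?thesis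
      unfolding I_def by (fastforce simp: abs_le_iff)
  qed
  finally show ?thesis
    by (simp only: of_nat_bit of_bool_eq_iff)
qed

text \<open>Write \<open>24 * n + 7\<close> as
  \<open>4 * (24 * pentagonal s + 1) + 3 * (8 * triangle k + 1)\<close>. Both brackets are squares,
  which gives \<open>u = \<bar>12 * s + 2\<bar>\<close> and \<open>v = 2 * k + 1\<close>;
  congruences modulo 8 and 3 show that every solution has this shape.\<close>

lemma card_pentagonal_triangle:
  "card {(s, k). n = 4 * pentagonal s + triangle k} =
   card {(u::nat, v::nat). u\<^sup>2 + 3 * v\<^sup>2 = 24 * n + 7}"
proof -
  define f where "f = (\<lambda>(s, k). (nat \<bar>12 * s + 2\<bar>, 2 * k + 1 :: nat))"
  have form_value: "int ((nat \<bar>12 * s + 2\<bar>)\<^sup>2 + 3 * (2 * k + 1)\<^sup>2) = int (24 * (4 * pentagonal s + triangle k) + 7)"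
    for s k
  proof -
    have "int ((nat \<bar>12 * s + 2\<bar>)\<^sup>2) = 4 * (6 * s + 1)\<^sup>2"
      by (simp add: power2_eq_square algebra_simps)
    then show ?thesis
      unfolding pentagonal_square[symmetric] triangle_square[symmetric] by simp
  qed
  have "inj f"
  proof (rule injI)
    fix x y assume "f x = f y"
    then obtain s k s' k' where "x = (s, k)" "y = (s', k')" "\<bar>12 * s + 2\<bar> = \<bar>12 * s' + 2\<bar>" "k = k'"
      by (cases x, cases y) (auto simp: f_def)
    \<comment> \<open>This rules out the sign case
      \<open>12 * s + 2 = - (12 * s' + 2)\<close>.\<close>
    moreover have "3 * (s + s') \<noteq> -1" by presburger
    ultimately have "s = s'"
      by (auto simp: abs_eq_iff)
    with \<open>x = (s, k)\<close> \<open>y = (s', k')\<close> \<open>k = k'\<close> show "x = y" by simp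
  qed
  have "f ` {(s, k). n = 4 * pentagonal s + triangle k} = {(u, v). u\<^sup>2 + 3 * v\<^sup>2 = 24 * n + 7}"
  proof (intro equalityI subsetI)
    fix x assume "x \<in> f ` {(s, k). n = 4 * pentagonal s + triangle k}"
    then show "x \<in> {(u, v). u\<^sup>2 + 3 * v\<^sup>2 = 24 * n + 7}"
      using form_value unfolding f_def of_nat_eq_iff by auto
  next
    fix x assume "x \<in> {(u::nat, v::nat). u\<^sup>2 + 3 * v\<^sup>2 = 24 * n + 7}"
    then obtain u v where x: "x = (u, v)" and uv: "u\<^sup>2 + 3 * v\<^sup>2 = 24 * n + 7"
      by auto
    have m8: "((u mod 8)\<^sup>2 + 3 * (v mod 8)\<^sup>2) mod 8 = 7"
    proof -
      have "((u mod 8)\<^sup>2 + 3 * (v mod 8)\<^sup>2) mod 8 = (u\<^sup>2 + 3 * v\<^sup>2) mod 8"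
        by (intro mod_add_cong mod_mult_cong) (simp_all add: power_mod)
      also have "\<dots> = 7" unfolding uv by presburger
      finally show ?thesis .
    qed
    have m3: "(u mod 3)\<^sup>2 mod 3 = 1"
    proof -
      have "(u mod 3)\<^sup>2 mod 3 = (u\<^sup>2 + 3 * v\<^sup>2) mod 3"
        by (simp add: power_mod)
      also have "\<dots> = 1" unfolding uv by presburger
      finally show ?thesis .
    qed
    \<comment> \<open>Checking all residues modulo 8 leaves \<open>v\<close> odd and
      \<open>u\<close> twice an odd number. As 3 does not divide \<open>u\<close>, it is 2 or 10
      modulo 12; the two cases belong to nonnegative and negative \<open>s\<close>.\<close>
    have "u mod 8 \<in> {0..<8}" "v mod 8 \<in> {0..<8}" by auto
    moreover have "{0..<8::nat} = {0,1,2,3,4,5,6,7}" by auto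
    ultimately have "u mod 8 \<in> {0,1,2,3,4,5,6,7}" "v mod 8 \<in> {0,1,2,3,4,5,6,7}" by simp_all
    then have "(u mod 8 = 2 \<or> u mod 8 = 6) \<and> odd (v mod 8)"
      using m8 by (elim insertE) simp_all
    then have 1: "u mod 4 = 2" "odd v"
      by presburger+
    have "u mod 3 \<noteq> 0" using m3 by (intro notI) simp
    with 1 have "u mod 12 = 2 \<or> u mod 12 = 10" by presburger
    then have "\<exists>s. int u = \<bar>12 * s + 2\<bar>"
    proof
      assume "u mod 12 = 2"
      then obtain t where "u = 12 * t + 2"
        by (metis mult_div_mod_eq)
      then have "int u = \<bar>12 * int t + 2\<bar>" by linarith
      then show ?thesis ..
    next
      assume "u mod 12 = 10"
      then obtain t where "u = 12 * t + 10"
        by (metis mult_div_mod_eq)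
      then have "int u = \<bar>12 * (- int t - 1) + 2\<bar>"
        by (simp add: algebra_simps)
      then show ?thesis ..
    qed
    then obtain s where s: "u = nat \<bar>12 * s + 2\<bar>" by (metis nat_int)
    obtain k where k: "v = 2 * k + 1" using 1 by (elim oddE)
    have "n = 4 * pentagonal s + triangle k"
      using form_value[of s k] uv unfolding of_nat_eq_iff s k by simp
    then show "x \<in> f ` {(s, k). n = 4 * pentagonal s + triangle k}"
      unfolding x s k f_def by force
  qed
  then show ?thesis
    using card_image[OF inj_on_subset[OF \<open>inj f\<close> subset_UNIV]] by metis
qed

section \<open>Primitive representations and square roots of \<open>-3\<close>\<close>

text \<open>Serves for correspondences that are given by congruences, so that existence and
  uniqueness can be argued in each direction without a formula for the map.\<close>

lemma card_eq_if_bijective_relation: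
  assumes "\<And>x. x \<in> A \<Longrightarrow> \<exists>y\<in>B. R x y" "\<And>y. y \<in> B \<Longrightarrow> \<exists>x\<in>A. R x y"
    and "\<And>x y y'. x \<in> A \<Longrightarrow> y \<in> B \<Longrightarrow> y' \<in> B \<Longrightarrow> R x y \<Longrightarrow> R x y' \<Longrightarrow> y = y'"
    and "\<And>x x' y. x \<in> A \<Longrightarrow> x' \<in> A \<Longrightarrow> y \<in> B \<Longrightarrow> R x y \<Longrightarrow> R x' y \<Longrightarrow> x = x'"
  shows "card A = card B"
proof -
  obtain f where f: "\<And>x. x \<in> A \<Longrightarrow> f x \<in> B \<and> R x (f x)"
    using assms(1) by metis
  have "bij_betw f A B"
    unfolding bij_betw_def
  proof
    show "inj_on f A"
      by (rule inj_onI) (metis assms(4) f)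
    show "f ` A = B"
    proof (intro equalityI subsetI)
      fix y assume "y \<in> B"
      then obtain x where "x \<in> A" "R x y" using assms(2) by blast
      then have "f x = y" using assms(3) f \<open>y \<in> B\<close> by blast
      then show "y \<in> f ` A" using \<open>x \<in> A\<close> by blast
    qed (use f in blast)
  qed
  then show ?thesis by (rule bij_betw_same_card)
qed

text \<open>Thue's lemma by the pigeonhole principle: with \<open>k\<close> the integer square root
  of \<open>M\<close> there are more than \<open>M\<close> pairs in the square of side
  \<open>k\<close>, so two of them share the value of \<open>x - z * y\<close> modulo
  \<open>M\<close>. Their difference is the required pair.\<close>

lemma thue:
  fixes M z :: int
  assumes "M > 0"
  obtains u v where "(u, v) \<noteq> (0, 0)" "u\<^sup>2 \<le> M" "v\<^sup>2 \<le> M" "M dvd u - z * v"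
proof -
  define k where "k = floor_sqrt (nat M)"
  have "k\<^sup>2 \<le> nat M" and "nat M < (Suc k)\<^sup>2"
    by (auto simp: k_def Suc_floor_sqrt_power2_gt)
  then have k: "(int k)\<^sup>2 \<le> M"
    using assms by (simp add: le_nat_iff)
  define I where "I = {0..int k} \<times> {0..int k}"
  define f where "f = (\<lambda>(x, y). (x - z * y) mod M)"
  have "f ` I \<subseteq> {0..<M}"
    using assms by (auto simp: f_def)
  then have "card (f ` I) \<le> nat M"
    using card_mono[of "{0..<M}" "f ` I"] by simp
  also have "\<dots> < card I"
    using \<open>nat M < (Suc k)\<^sup>2\<close> by (simp add: I_def card_cartesian_product power2_eq_square nat_add_distrib)
  finally have "\<not> inj_on f I"
    by (rule pigeonhole)
  then obtain x y x' y' where *: "(x, y) \<in> I" "(x', y') \<in> I" "(x, y) \<noteq> (x', y')" "f (x, y) = f (x', y')"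
    by (auto simp: inj_on_def)
  have bound: "(a - b)\<^sup>2 \<le> M" if "a \<in> {0..int k}" "b \<in> {0..int k}" for a b
  proof -
    have "\<bar>a - b\<bar> \<le> \<bar>int k\<bar>" using that by auto
    then have "(a - b)\<^sup>2 \<le> (int k)\<^sup>2" by (simp only: abs_le_square_iff)
    then show ?thesis using k by linarith
  qed
  have "M dvd (x - z * y) - (x' - z * y')"
    using *(4) by (simp add: f_def mod_eq_dvd_iff)
  then have "M dvd (x - x') - z * (y - y')"
    by (simp add: algebra_simps)
  moreover have "(x - x', y - y') \<noteq> (0, 0)" using *(3) by auto
  ultimately show ?thesis
    using that[of "x - x'" "y - y'"] bound *(1,2) by (auto simp: I_def)
qed

definition sqrts_minus_3 :: "int \<Rightarrow> int set" where
  "sqrts_minus_3 M = {z. 0 \<le> z \<and> z < M \<and> M dvd z\<^sup>2 + 3}"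

lemma finite_sqrts_minus_3 [simp]: "finite (sqrts_minus_3 M)"
  by (rule finite_subset[of _ "{0..<M}"]) (auto simp: sqrts_minus_3_def)

lemma dvd_congruent_form:
  fixes M u v z :: int
  assumes "M dvd u - z * v" "M dvd z\<^sup>2 + 3"
  shows "M dvd u\<^sup>2 + 3 * v\<^sup>2"
proof -
  have "u\<^sup>2 + 3 * v\<^sup>2 = (u - z * v) * (u + z * v) + (z\<^sup>2 + 3) * v\<^sup>2"
    by (simp add: power2_eq_square algebra_simps)
  then show ?thesis using assms by simp
qed

text \<open>Thue's lemma yields \<open>u\<^sup>2 + 3 * v\<^sup>2 = M * c\<close>, and
  \<open>c < 4\<close> because a nonsquare \<open>M\<close> makes both bounds strict. If
  \<open>c = 2\<close>, then \<open>u\<close> and \<open>v\<close> have equal parity, the form is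
  divisible by 4 and \<open>M\<close> would be even. If \<open>c = 3\<close>, then 3 divides
  \<open>u\<close>, and dividing by 3 exchanges the roles of the variables.\<close>

lemma sqrt_minus_3_represented:
  fixes M z :: int
  assumes "M > 0" "odd M" "\<not> 3 dvd M" "\<forall>k. k\<^sup>2 \<noteq> M" "M dvd z\<^sup>2 + 3"
  obtains u v where "u\<^sup>2 + 3 * v\<^sup>2 = M" "M dvd u - z * v"
proof -
  obtain u v where uv: "(u, v) \<noteq> (0, 0)" "u\<^sup>2 \<le> M" "v\<^sup>2 \<le> M" "M dvd u - z * v"
    using thue[OF \<open>M > 0\<close>] by blast
  have "u\<^sup>2 \<noteq> M" "v\<^sup>2 \<noteq> M" using assms(4) by auto
  then have "u\<^sup>2 + 3 * v\<^sup>2 < 4 * M" using uv by linarith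
  obtain c where c: "u\<^sup>2 + 3 * v\<^sup>2 = M * c"
    using dvd_congruent_form[OF uv(4) assms(5)] by (elim dvdE)
  have "u\<^sup>2 + 3 * v\<^sup>2 > 0"
    using uv(1) by (auto intro: add_pos_nonneg add_nonneg_pos)
  then have "c > 0" using c \<open>M > 0\<close> by (simp add: zero_less_mult_iff)
  have "M * c < M * 4" using c \<open>u\<^sup>2 + 3 * v\<^sup>2 < 4 * M\<close> by simp
  then have "c < 4" using \<open>M > 0\<close> by simp
  with \<open>c > 0\<close> consider "c = 1" | "c = 2" | "c = 3" by linarith
  then show ?thesis
  proof cases
    case 1
    then show ?thesis using that c uv(4) by simp
  next
    case 2
    have "even u \<longleftrightarrow> even v"
      using arg_cong[OF c, of even] 2 by simp
    then have "4 dvd u\<^sup>2 + 3 * v\<^sup>2"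
    proof (cases "even u")
      case True
      with \<open>even u \<longleftrightarrow> even v\<close> show ?thesis
        by (auto elim!: evenE simp: power2_eq_square)
    next
      case False
      with \<open>even u \<longleftrightarrow> even v\<close> obtain x y where "u = 2 * x + 1" "v = 2 * y + 1"
        by (metis oddE)
      then have "u\<^sup>2 + 3 * v\<^sup>2 = 4 * (x\<^sup>2 + x + 3 * y\<^sup>2 + 3 * y + 1)"
        by (simp add: power2_eq_square algebra_simps)
      then show ?thesis by simp
    qed
    then have "2 * 2 dvd M * 2" using c 2 by simp
    then have "even M" by (simp only: dvd_times_right_cancel_iff)
    with \<open>odd M\<close> show ?thesis by simp
  next
    case 3
    then have "u\<^sup>2 = 3 * (M - v\<^sup>2)" using c by simp
    then have "3 dvd u\<^sup>2" by simp
    then have "3 dvd u" by (rule prime_dvd_power[rotated]) simp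
    then obtain w where w: "u = 3 * w" by (elim dvdE)
    \<comment> \<open>The sign of \<open>w\<close> is chosen so that the new pair belongs to the
      same root \<open>z\<close>.\<close>
    have "v\<^sup>2 + 3 * (- w)\<^sup>2 = M"
      using c 3 w by (simp add: power2_eq_square)
    moreover have "M dvd v - z * (- w)"
    proof -
      have "3 * (v - z * (- w)) = z * (u - z * v) + (z\<^sup>2 + 3) * v"
        by (simp add: w power2_eq_square algebra_simps)
      then have "M dvd 3 * (v - z * (- w))"
        using uv(4) assms(5) by simp
      moreover have "coprime M 3"
        using assms(3) prime_imp_coprime[of 3 M] by (simp add: coprime_commute)
      ultimately show ?thesis
        by (simp only: coprime_dvd_mult_right_iff)
    qed
    ultimately show ?thesis using that by blast
  qed
qed

text \<open>Substituting \<open>u = z * v + M * k\<close> into the form and dividing by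
  \<open>M\<close> writes 1 as a combination of \<open>v\<close> and \<open>M\<close>. A common
  divisor of \<open>u\<close> and \<open>v\<close> divides both of these.\<close>

lemma coprime_of_congruent_form:
  fixes M u v z :: int
  assumes "M > 0" "u\<^sup>2 + 3 * v\<^sup>2 = M" "M dvd u - z * v" "M dvd z\<^sup>2 + 3"
  shows "coprime u v"
proof (rule coprimeI)
  fix d assume d: "d dvd u" "d dvd v"
  obtain k where "u - z * v = M * k" using assms(3) by (elim dvdE)
  then have k: "u = z * v + M * k" by simp
  obtain t where t: "z\<^sup>2 + 3 = M * t" using assms(4) by (elim dvdE)
  have "M * 1 = (z\<^sup>2 + 3) * v\<^sup>2 + M * (2 * z * v * k + M * k\<^sup>2)"
    using assms(2) unfolding k by (simp add: power2_eq_square algebra_simps)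
  also have "\<dots> = M * (t * v\<^sup>2 + 2 * z * v * k + M * k\<^sup>2)"
    unfolding t by (simp add: algebra_simps)
  finally have "1 = t * v\<^sup>2 + 2 * z * v * k + M * k\<^sup>2"
    using assms(1) by simp
  moreover have "d dvd M"
    unfolding assms(2)[symmetric] power2_eq_square using d by simp
  then have "d dvd t * v\<^sup>2 + 2 * z * v * k + M * k\<^sup>2"
    using d by (simp add: power2_eq_square)
  ultimately show "is_unit d" by simp
qed

text \<open>Brahmagupta's identity expresses \<open>M\<^sup>2\<close> as a value of the form whose
  second entry is \<open>u * v' - u' * v\<close>. This entry is a multiple of \<open>M\<close>, so
  the factor 3 forces it to vanish: the pairs are proportional, and coprimality and positivity make
  them equal.\<close>

lemma congruent_form_unique:
  fixes M u v u' v' z :: int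
  assumes "M > 0" "u\<^sup>2 + 3 * v\<^sup>2 = M" "u'\<^sup>2 + 3 * v'\<^sup>2 = M"
    and "M dvd u - z * v" "M dvd u' - z * v'"
    and "u > 0" "u' > 0" "coprime u v" "coprime u' v'"
  shows "u = u'" "v = v'"
proof -
  have "u * v' - u' * v = (u - z * v) * v' - (u' - z * v') * v"
    by (simp add: algebra_simps)
  then have "M dvd u * v' - u' * v" using assms(4,5) by simp
  then obtain b where b: "u * v' - u' * v = M * b" by (elim dvdE)
  have "M\<^sup>2 = (u * u' + 3 * v * v')\<^sup>2 + 3 * (u * v' - u' * v)\<^sup>2"
    unfolding power2_eq_square[of M]
    by (subst (1) assms(2)[symmetric], subst assms(3)[symmetric])
       (simp add: power2_eq_square algebra_simps)
  then have "3 * (M * b)\<^sup>2 \<le> M\<^sup>2"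
    unfolding b by simp
  then have "M\<^sup>2 * (3 * b\<^sup>2) \<le> M\<^sup>2 * 1"
    by (simp add: power_mult_distrib)
  then have "3 * b\<^sup>2 \<le> 1"
    using assms(1) by (subst (asm) mult_le_cancel_left_pos) simp_all
  then have "b\<^sup>2 = 0"
    using zero_le_power2[of b] by linarith
  then have eq: "u * v' = u' * v"
    using b by simp
  have "u dvd u' * v" "u' dvd u * v'"
    using eq by (metis dvd_triv_left)+
  then have "u dvd u'" "u' dvd u"
    using assms(8,9) by (simp_all add: coprime_dvd_mult_left_iff)
  then show "u = u'"
    using assms(6,7) by (simp add: zdvd_antisym_nonneg)
  with eq assms(6) show "v = v'" by simp
qed

definition primitive_reps :: "nat \<Rightarrow> (nat \<times> nat) set" where
  "primitive_reps M = {(u, v). coprime u v \<and> u\<^sup>2 + 3 * v\<^sup>2 = M}"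

lemma finite_form_reps: "finite {(u::nat, v::nat). u\<^sup>2 + 3 * v\<^sup>2 = M}"
proof (rule finite_subset)
  have le: "x \<le> x\<^sup>2" for x :: nat
    by (simp add: power2_nat_le_imp_le)
  have "u \<le> M \<and> v \<le> M" if "u\<^sup>2 + 3 * v\<^sup>2 = M" for u v :: nat
    using that le[of u] le[of v] by linarith
  then show "{(u::nat, v::nat). u\<^sup>2 + 3 * v\<^sup>2 = M} \<subseteq> {..M} \<times> {..M}"
    by auto
qed simp

lemma finite_primitive_reps: "finite (primitive_reps M)"
  by (rule finite_subset[OF _ finite_form_reps[of M]]) (auto simp: primitive_reps_def)

text \<open>A coprime integer solution corresponds to the root \<open>u / v\<close> modulo
  \<open>M\<close>, and \<open>(u, v)\<close> and \<open>(- u, - v)\<close> give the same root,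
  whence the normalisation \<open>u > 0\<close> in \<open>S\<close>. The sign of \<open>v\<close>
  remains free and accounts for the factor 2. Here \<open>u\<close> is nonzero because 3 does not
  divide \<open>M\<close>, and \<open>v\<close> because \<open>M\<close> is not a square.\<close>

lemma card_sqrts_minus_3:
  fixes M :: nat
  assumes "odd M" "\<not> 3 dvd M" "\<forall>k. k\<^sup>2 \<noteq> M"
  shows "card (sqrts_minus_3 (int M)) = 2 * card (primitive_reps M)"
proof -
  have M_pos: "int M > 0" using assms(1) by (cases M) auto
  have M_nonsquare: "\<forall>k. k\<^sup>2 \<noteq> int M"
  proof (intro allI notI)
    fix k assume "k\<^sup>2 = int M"
    then have "int ((nat \<bar>k\<bar>)\<^sup>2) = int M" by simp
    then show False using assms(3) by (simp only: of_nat_eq_iff)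
  qed
  have M_odd: "odd (int M)" "\<not> 3 dvd int M" using assms by presburger+
  define S where "S = {(u::int, v::int). u > 0 \<and> coprime u v \<and> u\<^sup>2 + 3 * v\<^sup>2 = int M}"
  have nonzero: "u \<noteq> 0" "v \<noteq> 0" if "u\<^sup>2 + 3 * v\<^sup>2 = int M" for u v
  proof -
    show "u \<noteq> 0" using that M_odd(2) by (metis add_0 dvd_triv_left power_zero_numeral)
    show "v \<noteq> 0" using that M_nonsquare by auto
  qed
  have "card S = card (sqrts_minus_3 (int M))"
  proof (rule card_eq_if_bijective_relation[where R = "\<lambda>x z. int M dvd fst x - z * snd x"])
    fix x assume "x \<in> S"
    then obtain u v where x: "x = (u, v)" and uv: "coprime u v" "u\<^sup>2 + 3 * v\<^sup>2 = int M"
      by (auto simp: S_def)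
    have cop: "coprime v (int M)"
    proof -
      have "gcd v ((3 * v) * v + u\<^sup>2) = gcd v (u\<^sup>2)"
        by (rule gcd_add_mult)
      moreover have "(3 * v) * v + u\<^sup>2 = int M"
        using uv(2) by (simp add: power2_eq_square)
      moreover have "coprime v (u\<^sup>2)"
        using uv(1) by (simp add: coprime_commute)
      ultimately show ?thesis by (simp add: coprime_iff_gcd_eq_1)
    qed
    then obtain w where "[v * w = 1] (mod int M)"
      using cong_solve_coprime_int by blast
    then have w: "int M dvd v * w - 1" by (simp add: cong_iff_dvd_diff)
    define z where "z = (u * w) mod int M"
    have "int M dvd u * w - z" by (simp add: z_def)
    moreover have "u - z * v = (u * w - z) * v - (v * w - 1) * u"
      by (simp add: algebra_simps)
    ultimately have z: "int M dvd u - z * v" using w by simp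
    have "(z\<^sup>2 + 3) * v\<^sup>2 = int M - (u - z * v) * (u + z * v)"
      unfolding uv(2)[symmetric] by (simp add: power2_eq_square algebra_simps)
    then have "int M dvd (z\<^sup>2 + 3) * v\<^sup>2" using z by simp
    then have "int M dvd z\<^sup>2 + 3"
      using cop by (simp add: coprime_dvd_mult_left_iff coprime_commute)
    then have "z \<in> sqrts_minus_3 (int M)"
      using M_pos by (simp add: sqrts_minus_3_def z_def)
    with z show "\<exists>z\<in>sqrts_minus_3 (int M). int M dvd fst x - z * snd x"
      unfolding x by auto
    fix z z' assume z: "z \<in> sqrts_minus_3 (int M)" "z' \<in> sqrts_minus_3 (int M)"
      "int M dvd fst x - z * snd x" "int M dvd fst x - z' * snd x"
    have "int M dvd (z - z') * v"
      using dvd_diff[OF z(4,3)] by (simp add: x algebra_simps)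
    then have "int M dvd z - z'"
      using cop by (simp add: coprime_dvd_mult_left_iff coprime_commute)
    then have "z mod int M = z' mod int M" by (simp add: mod_eq_dvd_iff)
    then show "z = z'" using z(1,2) by (simp add: sqrts_minus_3_def)
  next
    fix z assume "z \<in> sqrts_minus_3 (int M)"
    then have z: "int M dvd z\<^sup>2 + 3" by (simp add: sqrts_minus_3_def)
    obtain u v where uv: "u\<^sup>2 + 3 * v\<^sup>2 = int M" "int M dvd u - z * v"
      using sqrt_minus_3_represented[OF M_pos M_odd M_nonsquare z] by blast
    note cop = coprime_of_congruent_form[OF M_pos uv z]
    show "\<exists>x\<in>S. int M dvd fst x - z * snd x"
    proof (cases "u > 0")
      case True
      then have "(u, v) \<in> S" using cop uv by (simp add: S_def)
      then show ?thesis using uv by force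
    next
      case False
      then have "(- u, - v) \<in> S" using cop uv nonzero(1)[OF uv(1)] by (simp add: S_def)
      moreover have "int M dvd - u - z * (- v)"
        using uv(2) dvd_minus_iff[of "int M" "u - z * v"] by simp
      ultimately show ?thesis by force
    qed
  next
    fix x x' z
    assume "x \<in> S" "x' \<in> S" and dvd: "int M dvd fst x - z * snd x" "int M dvd fst x' - z * snd x'"
    then obtain u v u' v' where x: "x = (u, v)" "x' = (u', v')"
      and uv: "u\<^sup>2 + 3 * v\<^sup>2 = int M" "u'\<^sup>2 + 3 * v'\<^sup>2 = int M"
        "u > 0" "u' > 0" "coprime u v" "coprime u' v'"
      unfolding S_def by blast
    have "u = u' \<and> v = v'"
      using congruent_form_unique[OF M_pos uv(1,2) _ _ uv(3-6), of z] dvd unfolding x by simp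
    then show "x = x'" unfolding x by simp
  qed
  moreover have "card S = 2 * card (primitive_reps M)"
  proof -
    define f where "f = (\<lambda>(s, u, v). (int u, s * int v))"
    have "inj_on f ({1, -1} \<times> primitive_reps M)"
    proof (rule inj_onI)
      fix x y assume *: "x \<in> {1, -1} \<times> primitive_reps M" "y \<in> {1, -1} \<times> primitive_reps M" "f x = f y"
      obtain s u v where x: "x = (s, u, v)" by (cases x)
      obtain s' u' v' where y: "y = (s', u', v')" by (cases y)
      have "u\<^sup>2 + 3 * v\<^sup>2 = M"
        using *(1) by (simp add: x primitive_reps_def)
      then have "(int u)\<^sup>2 + 3 * (int v)\<^sup>2 = int M"
        by (metis of_nat_add of_nat_mult of_nat_numeral of_nat_power)
      then have "int v \<noteq> 0" by (rule nonzero)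
      then show "x = y" using * by (auto simp: x y f_def)
    qed
    moreover have "f ` ({1, -1} \<times> primitive_reps M) = S"
    proof (intro equalityI subsetI)
      fix x assume "x \<in> f ` ({1, -1} \<times> primitive_reps M)"
      then obtain s u v where x: "x = (int u, s * int v)" "s \<in> {1, -1}" "coprime u v" "u\<^sup>2 + 3 * v\<^sup>2 = M"
        by (auto simp: f_def primitive_reps_def)
      have eq: "(int u)\<^sup>2 + 3 * (int v)\<^sup>2 = int M"
        unfolding x(4)[symmetric] by simp
      show "x \<in> S"
        using x nonzero(1)[OF eq] eq by (auto simp: S_def)
    next
      fix x assume "x \<in> S"
      then obtain u v where x: "x = (u, v)" "u > 0" "coprime u v" "u\<^sup>2 + 3 * v\<^sup>2 = int M"
        by (auto simp: S_def)
      have "int ((nat u)\<^sup>2 + 3 * (nat \<bar>v\<bar>)\<^sup>2) = int M" using x by simp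
      then have "(nat u)\<^sup>2 + 3 * (nat \<bar>v\<bar>)\<^sup>2 = M" by (simp only: of_nat_eq_iff)
      moreover have "coprime (int (nat u)) (int (nat \<bar>v\<bar>))" using x by simp
      then have "coprime (nat u) (nat \<bar>v\<bar>)" by (simp only: coprime_int_iff)
      ultimately have "(nat u, nat \<bar>v\<bar>) \<in> primitive_reps M" by (simp add: primitive_reps_def)
      moreover have "x = f (sgn v, nat u, nat \<bar>v\<bar>)" using x by (simp add: f_def mult_sgn_abs)
      moreover have "sgn v \<in> {1, -1}" using nonzero(2)[OF x(4)] by (auto simp: sgn_if)
      ultimately show "x \<in> f ` ({1, -1} \<times> primitive_reps M)" by blast
    qed
    ultimately have "card S = card ({1, -1 :: int} \<times> primitive_reps M)"
      by (metis card_image)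
    then show ?thesis by (simp add: card_cartesian_product)
  qed
  ultimately show ?thesis by simp
qed

section \<open>The number of square roots of -3 modulo M\<close>

lemma mod_in_sqrts_minus_3:
  assumes "M > 0" "M dvd z\<^sup>2 + 3"
  shows "z mod M \<in> sqrts_minus_3 M"
proof -
  have "((z mod M)\<^sup>2 + 3) mod M = (z\<^sup>2 + 3) mod M"
    by (intro mod_add_cong) (simp_all add: power_mod)
  then have "M dvd (z mod M)\<^sup>2 + 3"
    using assms(2) by (simp add: dvd_eq_mod_eq_0)
  then show ?thesis
    using assms(1) by (simp add: sqrts_minus_3_def)
qed

lemma uminus_in_sqrts_minus_3:
  assumes "A > 1" "\<not> 3 dvd A" "z \<in> sqrts_minus_3 A"
  shows "z > 0" "A - z \<in> sqrts_minus_3 A"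
proof -
  have z: "0 \<le> z" "z < A" "A dvd z\<^sup>2 + 3"
    using assms(3) by (auto simp: sqrts_minus_3_def)
  have "z \<noteq> 0"
  proof
    assume "z = 0"
    then have "A dvd 3" using z by simp
    then have "A \<le> 3" by (rule zdvd_imp_le) simp
    then have "A = 2 \<or> A = 3" using assms(1) by auto
    then show False using \<open>A dvd 3\<close> assms(2) by auto
  qed
  then show "z > 0" using z by simp
  moreover have "(A - z)\<^sup>2 + 3 = A * (A - 2 * z) + (z\<^sup>2 + 3)"
    by (simp add: power2_eq_square algebra_simps)
  then have "A dvd (A - z)\<^sup>2 + 3" using z by (metis dvd_add dvd_triv_left)
  ultimately show "A - z \<in> sqrts_minus_3 A"
    using z by (simp add: sqrts_minus_3_def)
qed

text \<open>The involution \<open>z \<mapsto> A - z\<close> has no fixed point for odd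
  \<open>A\<close>; \<open>L\<close> contains the smaller root of each pair.\<close>

lemma even_card_sqrts_minus_3:
  assumes "A > 1" "odd A" "\<not> 3 dvd A"
  shows "even (card (sqrts_minus_3 A))"
proof -
  define L where "L = {z \<in> sqrts_minus_3 A. 2 * z < A}"
  note refl = uminus_in_sqrts_minus_3[OF assms(1,3)]
  have "sqrts_minus_3 A = L \<union> (\<lambda>z. A - z) ` L"
  proof (intro equalityI subsetI)
    fix z assume z: "z \<in> sqrts_minus_3 A"
    show "z \<in> L \<union> (\<lambda>z. A - z) ` L"
    proof (cases "2 * z < A")
      case False
      moreover have "2 * z \<noteq> A" using assms(2) by auto
      ultimately have "A - z \<in> L" using refl(2)[OF z] by (simp add: L_def)
      moreover have "z = A - (A - z)" by simp
      ultimately show ?thesis by blast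
    qed (use z in \<open>simp add: L_def\<close>)
  qed (use refl in \<open>auto simp: L_def\<close>)
  moreover have "L \<inter> (\<lambda>z. A - z) ` L = {}"
    by (auto simp: L_def)
  moreover have "finite L" by (simp add: L_def)
  moreover have "card ((\<lambda>z. A - z) ` L) = card L"
    by (rule card_image) (simp add: inj_on_def)
  ultimately have "card (sqrts_minus_3 A) = card L + card L"
    by (simp add: card_Un_disjoint)
  then show ?thesis by simp
qed

text \<open>The Chinese remainder theorem: for coprime moduli the divisibility condition splits into
  one condition for each factor.\<close>

lemma card_sqrts_minus_3_mult:
  assumes "coprime A B" "A > 0" "B > 0"
  shows "card (sqrts_minus_3 (A * B)) = card (sqrts_minus_3 A) * card (sqrts_minus_3 B)"
proof -
  have "card (sqrts_minus_3 (A * B)) = card (sqrts_minus_3 A \<times> sqrts_minus_3 B)"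
  proof (rule card_eq_if_bijective_relation[where R = "\<lambda>z x. x = (z mod A, z mod B)"])
    fix z assume z: "z \<in> sqrts_minus_3 (A * B)"
    then have "A dvd z\<^sup>2 + 3" "B dvd z\<^sup>2 + 3"
      by (auto simp: sqrts_minus_3_def intro: dvd_mult_left dvd_mult_right)
    then show "\<exists>x\<in>sqrts_minus_3 A \<times> sqrts_minus_3 B. x = (z mod A, z mod B)"
      using assms mod_in_sqrts_minus_3 by simp
    fix z' x assume z': "z' \<in> sqrts_minus_3 (A * B)" and "x = (z mod A, z mod B)" "x = (z' mod A, z' mod B)"
    then have "z mod A = z' mod A" "z mod B = z' mod B" by auto
    then have "A dvd z - z'" "B dvd z - z'" by (simp_all only: mod_eq_dvd_iff)
    then have "A * B dvd z - z'" using assms(1) by (rule divides_mult)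
    then have "z mod (A * B) = z' mod (A * B)" by (simp add: mod_eq_dvd_iff)
    then show "z = z'" using z z' by (simp add: sqrts_minus_3_def)
  next
    fix x assume "x \<in> sqrts_minus_3 A \<times> sqrts_minus_3 B"
    then obtain a b where x: "x = (a, b)" "a \<in> sqrts_minus_3 A" "b \<in> sqrts_minus_3 B" by auto
    obtain z where "[z = a] (mod A)" "[z = b] (mod B)"
      using binary_chinese_remainder_int[OF assms(1)] by blast
    then have z: "z mod A = a" "z mod B = b"
      using x by (simp_all add: cong_def sqrts_minus_3_def)
    have "((z mod C)\<^sup>2 + 3) mod C = (z\<^sup>2 + 3) mod C" for C
      by (intro mod_add_cong) (simp_all add: power_mod)
    then have "A dvd z\<^sup>2 + 3" "B dvd z\<^sup>2 + 3"
      using x z by (metis (mono_tags, lifting) dvd_eq_mod_eq_0 mem_Collect_eq sqrts_minus_3_def)+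
    then have "A * B dvd z\<^sup>2 + 3" using assms(1) by (rule divides_mult)
    then have "z mod (A * B) \<in> sqrts_minus_3 (A * B)"
      using assms by (intro mod_in_sqrts_minus_3) simp_all
    moreover have "x = (z mod (A * B) mod A, z mod (A * B) mod B)"
      using z x by (simp add: mod_mod_cancel)
    ultimately show "\<exists>z\<in>sqrts_minus_3 (A * B). x = (z mod A, z mod B)" by blast
  qed auto
  then show ?thesis by (simp add: card_cartesian_product)
qed

text \<open>Since 3 divides \<open>totient (p ^ e)\<close>, a suitable power \<open>w\<close> of a
  primitive root is a nontrivial cube root of unity. Then \<open>w\<^sup>2 + w + 1\<close> vanishes
  modulo \<open>p ^ e\<close>, and four times it is \<open>(2 * w + 1)\<^sup>2 + 3\<close>.\<close>

lemma exists_sqrt_minus_3_prime_power: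
  fixes p e :: nat
  assumes "prime p" "p mod 3 = 1" "e > 0"
  shows "\<exists>z. p ^ e dvd z\<^sup>2 + 3"
proof -
  have "p \<noteq> 2" using assms(2) by auto
  then have "odd p" using assms(1) prime_odd_nat prime_gt_1_nat[of p] by fastforce
  then obtain g where g: "\<forall>k>0. residue_primroot (p ^ k) g"
    using residue_primroot_odd_prime_power_exists[OF assms(1)] by blast
  obtain t where t: "p = 3 * t + 1"
    using assms(2) by (metis mult_div_mod_eq)
  have "t > 0" using t assms(1) by (cases t) auto
  define w where "w = g ^ (p ^ (e - 1) * t)"
  have "totient (p ^ e) = p ^ (e - 1) * t * 3"
    using totient_prime_power[OF assms(1,3)] t by simp
  moreover have "coprime g (p ^ e)"
    using g assms(3) by (auto simp: residue_primroot_def coprime_commute)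
  ultimately have "[w ^ 3 = 1] (mod p ^ e)"
    using euler_theorem[of g "p ^ e"] by (simp add: w_def flip: power_mult)
  then have w3: "int (p ^ e) dvd int w ^ 3 - 1"
    by (metis cong_iff_dvd_diff cong_int_iff of_nat_1 of_nat_power)
  \<comment> \<open>To cancel \<open>w - 1\<close> modulo \<open>p ^ e\<close>, it must be nonzero
    modulo \<open>p\<close> itself. This holds because the same \<open>g\<close> is a primitive root
    modulo \<open>p\<close>.\<close>
  have "\<not> [w = 1] (mod p)"
  proof
    assume "[w = 1] (mod p)"
    then have "ord p g dvd p ^ (e - 1) * t"
      by (simp only: w_def ord_divides)
    moreover have "ord p g = 3 * t"
      using g[rule_format, of 1] t assms(1) by (simp add: residue_primroot_def totient_prime)
    ultimately have "3 dvd p ^ (e - 1)" using \<open>t > 0\<close> by simp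
    then have "3 dvd p" by (rule prime_dvd_power[rotated]) simp
    then show False using assms(2) by auto
  qed
  then have "\<not> int p dvd int w - 1"
    by (metis cong_iff_dvd_diff cong_int_iff of_nat_1)
  then have "coprime (int p) (int w - 1)"
    using assms(1) by (intro prime_imp_coprime) simp_all
  then have "coprime (int (p ^ e)) (int w - 1)" by simp
  moreover have "int w ^ 3 - 1 = (int w - 1) * int (w\<^sup>2 + w + 1)"
    by (simp add: power2_eq_square power3_eq_cube algebra_simps)
  ultimately have "int (p ^ e) dvd int (w\<^sup>2 + w + 1)"
    using w3 by (simp only: coprime_dvd_mult_right_iff)
  then have "p ^ e dvd w\<^sup>2 + w + 1" by (simp only: of_nat_dvd_iff)
  moreover have "(2 * w + 1)\<^sup>2 + 3 = 4 * (w\<^sup>2 + w + 1)"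
    by (simp add: power2_eq_square)
  ultimately have "p ^ e dvd (2 * w + 1)\<^sup>2 + 3" by (metis dvd_mult)
  then show ?thesis by blast
qed

text \<open>For two roots \<open>x\<close> and \<open>z\<close>, the modulus divides
  \<open>(x - z) * (x + z)\<close>. If \<open>p\<close> divided both factors, it would divide
  \<open>2 * z\<close>, hence \<open>z\<close>, hence 3. So the whole prime power divides one
  factor.\<close>

lemma card_sqrts_minus_3_prime_power:
  fixes p e :: nat
  assumes "prime p" "p mod 3 = 1" "e > 0"
  shows "card (sqrts_minus_3 (int (p ^ e))) = 2"
proof -
  define M where "M = int (p ^ e)"
  have "odd p" using assms(1,2) prime_odd_nat[of p] prime_ge_2_nat[of p] by (cases "p = 2") auto
  then have M_odd: "odd M" by (simp add: M_def)
  have "\<not> 3 dvd p" using assms(2) by auto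
  have p3: "\<not> int p dvd 3"
  proof
    assume "int p dvd 3"
    then have "p dvd 3" using int_dvd_int_iff[of p 3] by simp
    then have "p \<le> 3" by (rule dvd_imp_le) simp
    then have "p = 1" using assms(2) by (cases "p = 2"; cases "p = 3"; cases "p = 0") auto
    then show False using assms(1) by simp
  qed
  have M1: "M > 1"
    using assms(1,3) prime_gt_1_nat[of p] by (simp add: M_def)
  have M3: "\<not> 3 dvd M"
  proof
    assume "3 dvd M"
    then have "3 dvd p ^ e" unfolding M_def by (metis int_dvd_int_iff of_nat_numeral)
    then have "3 dvd p" by (rule prime_dvd_power[rotated]) simp
    with \<open>\<not> 3 dvd p\<close> show False ..
  qed
  obtain z0 where "p ^ e dvd z0\<^sup>2 + 3"
    using exists_sqrt_minus_3_prime_power[OF assms] by blast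
  then have "M dvd (int z0)\<^sup>2 + 3"
    unfolding M_def by (metis int_dvd_int_iff of_nat_add of_nat_numeral of_nat_power)
  then obtain z where z: "z \<in> sqrts_minus_3 M"
    using mod_in_sqrts_minus_3[of M "int z0"] M1 by force
  have pM: "int p dvd M" using assms(3) by (simp add: M_def)
  have "sqrts_minus_3 M = {z, M - z}"
  proof (intro equalityI subsetI)
    fix x assume x: "x \<in> sqrts_minus_3 M"
    have "M dvd (x\<^sup>2 + 3) - (z\<^sup>2 + 3)"
      using x z by (intro dvd_diff) (auto simp: sqrts_minus_3_def)
    then have dvd: "M dvd (x - z) * (x + z)"
      by (simp add: power2_eq_square algebra_simps)
    have "\<not> (int p dvd x - z \<and> int p dvd x + z)"
    proof
      assume *: "int p dvd x - z \<and> int p dvd x + z"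
      then have "int p dvd (x + z) - (x - z)" by (blast intro: dvd_diff)
      then have "int p dvd 2 * z" by simp
      moreover have "coprime (int p) 2" using \<open>odd p\<close> by simp
      ultimately have "int p dvd z" by (simp only: coprime_dvd_mult_right_iff)
      moreover have "int p dvd z\<^sup>2 + 3"
        using z pM by (auto simp: sqrts_minus_3_def intro: dvd_trans)
      ultimately have "int p dvd 3"
        by (metis dvd_add_right_iff dvd_power pos2 dvd_trans)
      then show False using p3 by simp
    qed
    then have "coprime (int p) (x - z) \<or> coprime (int p) (x + z)"
      using assms(1) prime_imp_coprime[of "int p"] by auto
    then have "coprime M (x - z) \<or> coprime M (x + z)" by (auto simp: M_def)
    then have "M dvd x + z \<or> M dvd x - z"
      using dvd coprime_dvd_mult_right_iff coprime_dvd_mult_left_iff by blast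
    then show "x \<in> {z, M - z}"
    proof
      assume "M dvd x - z"
      then have "x mod M = z mod M" by (simp add: mod_eq_dvd_iff)
      then show ?thesis using x z by (simp add: sqrts_minus_3_def)
    next
      assume "M dvd x + z"
      then have "M dvd x - (M - z)" by (metis add_diff_eq diff_diff_eq2 dvd_diff dvd_refl)
      then have "x mod M = (M - z) mod M" by (simp only: mod_eq_dvd_iff)
      moreover have "M - z \<in> sqrts_minus_3 M"
        by (rule uminus_in_sqrts_minus_3[OF M1 M3 z])
      moreover have "y mod M = y" if "y \<in> sqrts_minus_3 M" for y
        using that by (simp add: sqrts_minus_3_def)
      ultimately show ?thesis using x by (metis insertCI)
    qed
  qed (use z uminus_in_sqrts_minus_3[OF M1 M3 z] in auto)
  moreover have "z \<noteq> M - z" using M_odd by presburger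
  ultimately show ?thesis unfolding M_def by simp
qed

section \<open>Counting representations\<close>

lemma square_mod_24:
  fixes d :: nat
  assumes "odd d" "\<not> 3 dvd d"
  shows "d\<^sup>2 mod 24 = 1"
proof -
  have "d mod 6 = 1 \<or> d mod 6 = 5" using assms by presburger
  then obtain q where "d = 6 * q + 1 \<or> d = 6 * q + 5" by (metis mult_div_mod_eq)
  then show ?thesis
  proof
    assume d: "d = 6 * q + 1"
    have "even (q * (3 * q + 1))" by simp
    then obtain r where r: "q * (3 * q + 1) = 2 * r" by (elim evenE)
    have "d\<^sup>2 = 12 * (q * (3 * q + 1)) + 1" by (simp add: d power2_eq_square algebra_simps)
    then show ?thesis unfolding r by presburger
  next
    assume d: "d = 6 * q + 5"
    have "even (q * (3 * q + 5))" by simp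
    then obtain r where r: "q * (3 * q + 5) = 2 * r" by (elim evenE)
    have "d\<^sup>2 = 12 * (q * (3 * q + 5)) + 25" by (simp add: d power2_eq_square algebra_simps)
    then show ?thesis unfolding r by presburger
  qed
qed

text \<open>Squares of units modulo 24 are 1, so the residue 7 passes to every cofactor of a square,
  and results for \<open>N\<close> apply to \<open>N div d\<^sup>2\<close> as well.\<close>

lemma cofactor_of_square_mod_24:
  fixes N d M :: nat
  assumes "N = d\<^sup>2 * M" "N mod 24 = 7"
  shows "M mod 24 = 7"
proof -
  have "odd N" "\<not> 3 dvd N" using assms(2) by presburger+
  then have "odd d" "\<not> 3 dvd d" unfolding assms(1) by auto
  then have "d\<^sup>2 mod 24 = 1" by (rule square_mod_24)
  then have "(d\<^sup>2 * M) mod 24 = M mod 24"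
    by (metis mod_mult_left_eq mult_1)
  then show ?thesis using assms by simp
qed

lemma not_square_mod_24:
  fixes N k :: nat
  assumes "N mod 24 = 7"
  shows "k\<^sup>2 \<noteq> N"
  \<comment> \<open>A square would have cofactor 1, whose residue is not 7.\<close>
  using cofactor_of_square_mod_24[of N k 1] assms by auto

lemma odd_card_primitive_reps_iff:
  fixes M :: nat
  assumes "M mod 24 = 7"
  shows "odd (card (primitive_reps M)) \<longleftrightarrow> primepow M"
proof -
  have M: "odd M" "\<not> 3 dvd M" using assms by presburger+
  have nonsquare: "\<forall>k. k\<^sup>2 \<noteq> M" using not_square_mod_24[OF assms] by blast
  note card = card_sqrts_minus_3[OF M nonsquare]
  show ?thesis
  proof
    assume "primepow M"
    then obtain p e where pe: "prime p" "e > 0" "M = p ^ e" by (auto simp: primepow_def)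
    \<comment> \<open>With \<open>e\<close> odd, \<open>p\<close> is itself the cofactor of a square
      in \<open>M\<close>, so it inherits the residue 7 and is 1 modulo 3.\<close>
    have "odd e"
    proof
      assume "even e"
      then have "M = (p ^ (e div 2))\<^sup>2" using pe by (simp flip: power_mult)
      then show False using nonsquare by metis
    qed
    then obtain j where j: "e = 2 * j + 1" by (elim oddE)
    have "M = (p ^ j)\<^sup>2 * p"
      unfolding pe(3) j by (simp add: mult.commute flip: power_mult)
    then have "p mod 24 = 7"
      using assms by (rule cofactor_of_square_mod_24)
    then have "p mod 3 = 1" by presburger
    then show "odd (card (primitive_reps M))"
      using card_sqrts_minus_3_prime_power[OF pe(1) _ pe(2)] card pe(3) by simp
  next
    assume odd_card: "odd (card (primitive_reps M))"
    show "primepow M"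
    proof (rule ccontr)
      assume not: "\<not> primepow M"
      have "M > 0" "M \<noteq> 1" using assms by auto
      \<comment> \<open>Splitting off the full power of one prime leaves two coprime factors above
        1, each with an even number of roots.\<close>
      then obtain p where p: "prime p" "p dvd M" using prime_factor_nat by blast
      obtain m where m: "M = p ^ multiplicity p M * m" "\<not> p dvd m"
        by (rule multiplicity_decompose'[of M p]) (use p \<open>M > 0\<close> in auto)
      define q where "q = p ^ multiplicity p M"
      have "multiplicity p M > 0"
        using p \<open>M > 0\<close> by (simp add: prime_multiplicity_gt_zero_iff)
      then have "primepow q" using p(1) by (simp add: q_def)
      then have "q > 1" using primepow_gt_Suc_0 by fastforce
      have "m \<noteq> 1" using m(1) not \<open>primepow q\<close> by (auto simp: q_def)
      moreover have "m \<noteq> 0" using m(2) by (metis dvd_0_right)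
      ultimately have "m > 1" by simp
      have Mqm: "M = q * m" using m(1) by (simp add: q_def)
      have "coprime q m"
        using p(1) m(2) by (simp add: q_def prime_imp_coprime)
      then have "card (sqrts_minus_3 (int M)) = card (sqrts_minus_3 (int q)) * card (sqrts_minus_3 (int m))"
        using card_sqrts_minus_3_mult[of "int q" "int m"] \<open>q > 1\<close> \<open>m > 1\<close> Mqm by simp
      moreover have "odd q" "odd m" "\<not> 3 dvd q" "\<not> 3 dvd m" using M unfolding Mqm by auto
      then have "odd (int q)" "odd (int m)" "\<not> 3 dvd int q" "\<not> 3 dvd int m" by presburger+
      then have "even (card (sqrts_minus_3 (int q)))" "even (card (sqrts_minus_3 (int m)))"
        using \<open>q > 1\<close> \<open>m > 1\<close> by (simp_all add: even_card_sqrts_minus_3)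
      ultimately have "4 dvd 2 * card (primitive_reps M)"
        unfolding card by (auto elim!: evenE)
      then show False using odd_card by presburger
    qed
  qed
qed

text \<open>Dividing by \<open>d = gcd u v\<close> partitions the solutions into copies of the
  primitive ones for \<open>N div d\<^sup>2\<close>. A finite sum is odd exactly when it has an odd
  number of odd terms, and here the odd terms belong to prime power cofactors.\<close>

lemma odd_card_form_reps_iff:
  fixes N :: nat
  assumes "N mod 24 = 7"
  shows "odd (card {(u::nat, v::nat). u\<^sup>2 + 3 * v\<^sup>2 = N}) \<longleftrightarrow>
    odd (card {d. d\<^sup>2 dvd N \<and> primepow (N div d\<^sup>2)})"
proof -
  define D where "D = {d. d\<^sup>2 dvd N}"
  define R where "R = (\<lambda>d. (\<lambda>(u, v). (d * u, d * v)) ` primitive_reps (N div d\<^sup>2))"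
  have "N > 0" using assms by (cases N) auto
  have "finite D"
  proof (rule finite_subset)
    show "D \<subseteq> {..N}"
    proof
      fix d assume "d \<in> D"
      then have "d dvd N" by (auto simp: D_def power2_eq_square intro: dvd_mult_left)
      then show "d \<in> {..N}" using \<open>N > 0\<close> by (auto dest: dvd_imp_le)
    qed
  qed simp
  have D_pos: "d > 0" if "d \<in> D" for d
    using that \<open>N > 0\<close> by (cases d) (auto simp: D_def)
  have "{(u, v). u\<^sup>2 + 3 * v\<^sup>2 = N} = (\<Union>d\<in>D. R d)"
  proof (intro equalityI subsetI)
    fix x assume "x \<in> {(u, v). u\<^sup>2 + 3 * v\<^sup>2 = N}"
    then obtain u v where x: "x = (u, v)" "u\<^sup>2 + 3 * v\<^sup>2 = N" by auto
    define d where "d = gcd u v"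
    have "u \<noteq> 0 \<or> v \<noteq> 0" using x(2) \<open>N > 0\<close> by auto
    then have "d > 0" by (simp add: d_def)
    then obtain u' v' where uv': "u = u' * d" "v = v' * d" "coprime u' v'"
      using gcd_coprime_exists[of u v] unfolding d_def by blast
    have N: "N = d\<^sup>2 * (u'\<^sup>2 + 3 * v'\<^sup>2)"
      using x(2) by (simp add: uv'(1,2) power2_eq_square algebra_simps)
    then have "d \<in> D" by (simp add: D_def)
    moreover have "(u', v') \<in> primitive_reps (N div d\<^sup>2)"
      using uv'(3) \<open>d > 0\<close> by (simp add: N primitive_reps_def)
    ultimately show "x \<in> (\<Union>d\<in>D. R d)"
      unfolding R_def x uv'(1,2) by (force simp: mult.commute)
  next
    fix x assume "x \<in> (\<Union>d\<in>D. R d)"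
    then obtain d u v where x: "d \<in> D" "x = (d * u, d * v)" "u\<^sup>2 + 3 * v\<^sup>2 = N div d\<^sup>2"
      by (auto simp: R_def primitive_reps_def)
    have "(d * u)\<^sup>2 + 3 * (d * v)\<^sup>2 = d\<^sup>2 * (N div d\<^sup>2)"
      unfolding x(3)[symmetric] by (simp add: power2_eq_square algebra_simps)
    also have "\<dots> = N" using x(1) by (simp add: D_def)
    finally show "x \<in> {(u, v). u\<^sup>2 + 3 * v\<^sup>2 = N}" using x(2) by simp
  qed
  also have "card \<dots> = (\<Sum>d\<in>D. card (R d))"
  proof (rule card_UN_disjoint[OF \<open>finite D\<close>])
    show "\<forall>d\<in>D. finite (R d)"
      by (simp add: R_def finite_primitive_reps)
    have "gcd (fst x) (snd x) = d" if x: "x \<in> R d" for d x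
    proof -
      obtain u v where "x = (d * u, d * v)" "coprime u v"
        using x by (auto simp: R_def primitive_reps_def)
      then show ?thesis by (simp flip: gcd_mult_distrib_nat)
    qed
    then show "\<forall>d\<in>D. \<forall>d'\<in>D. d \<noteq> d' \<longrightarrow> R d \<inter> R d' = {}" by blast
  qed
  also have "\<dots> = (\<Sum>d\<in>D. card (primitive_reps (N div d\<^sup>2)))"
  proof (rule sum.cong[OF refl])
    fix d assume "d \<in> D"
    then have "inj_on (\<lambda>(u, v). (d * u, d * v)) (primitive_reps (N div d\<^sup>2))"
      using D_pos[of d] by (auto simp: inj_on_def)
    then show "card (R d) = card (primitive_reps (N div d\<^sup>2))"
      unfolding R_def by (rule card_image)
  qed
  finally have "odd (card {(u, v). u\<^sup>2 + 3 * v\<^sup>2 = N}) \<longleftrightarrow>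
      odd (card {d\<in>D. odd (card (primitive_reps (N div d\<^sup>2)))})"
    using \<open>finite D\<close> by (simp add: even_sum_iff)
  also have "{d\<in>D. odd (card (primitive_reps (N div d\<^sup>2)))} = {d\<in>D. primepow (N div d\<^sup>2)}"
  proof -
    have "(N div d\<^sup>2) mod 24 = 7" if "d \<in> D" for d
      using that cofactor_of_square_mod_24[OF _ assms, of d] by (simp add: D_def)
    then show ?thesis using odd_card_primitive_reps_iff by blast
  qed
  finally show ?thesis by (simp add: D_def)
qed

text \<open>The prime is recovered as the only one of odd multiplicity; the exponent is that
  multiplicity.\<close>

lemma odd_prime_power_times_square_unique:
  fixes p q m k f g :: nat
  assumes "prime p" "prime q" "\<not> p dvd m" "\<not> q dvd k" "odd f" "odd g"
    and eq: "p ^ f * m\<^sup>2 = q ^ g * k\<^sup>2"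
  shows "p = q \<and> f = g \<and> m = k"
proof -
  have nz: "m \<noteq> 0" "k \<noteq> 0" using assms(3,4) by (auto intro: ccontr)
  have p: "multiplicity p (p ^ f * m\<^sup>2) = f"
    using assms(1,3) nz
    by (simp add: prime_elem_multiplicity_mult_distrib prime_elem_multiplicity_power_distrib not_dvd_imp_multiplicity_0)
  have "p = q"
  proof (rule ccontr)
    assume "p \<noteq> q"
    then have "multiplicity p (q ^ g * k\<^sup>2) = 2 * multiplicity p k"
      using assms(1,2) nz
      by (simp add: prime_elem_multiplicity_mult_distrib prime_elem_multiplicity_power_distrib prime_multiplicity_other)
    then show False using p eq \<open>odd f\<close> by (metis dvd_triv_left)
  qed
  moreover have "multiplicity q (q ^ g * k\<^sup>2) = g"
    using assms(2,4) nz
    by (simp add: prime_elem_multiplicity_mult_distrib prime_elem_multiplicity_power_distrib not_dvd_imp_multiplicity_0)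
  ultimately have "f = g" using p eq by simp
  with \<open>p = q\<close> have "m\<^sup>2 = k\<^sup>2" using eq assms(1) by simp
  then show ?thesis using \<open>p = q\<close> \<open>f = g\<close> by simp
qed

text \<open>If any such \<open>d\<close> exists, then \<open>N = p ^ (2 * g + 1) * m\<^sup>2\<close>
  with \<open>p\<close> not dividing \<open>m\<close>, and there are \<open>g + 1\<close> of them.
  This is odd exactly for even \<open>g\<close>, that is, for exponents
  \<open>4 * a + 1\<close>.\<close>

lemma odd_card_primepow_cofactors_iff:
  fixes N :: nat
  assumes nonsquare: "\<forall>k. k\<^sup>2 \<noteq> N"
  shows "odd (card {d. d\<^sup>2 dvd N \<and> primepow (N div d\<^sup>2)}) \<longleftrightarrow>
    (\<exists>p m a. prime p \<and> m > 0 \<and> \<not> p dvd m \<and> N = p ^ (4 * a + 1) * m\<^sup>2)"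
proof -
  define D where "D = {d. d\<^sup>2 dvd N \<and> primepow (N div d\<^sup>2)}"
  have decomp: "\<exists>p e j m. prime p \<and> odd e \<and> \<not> p dvd m \<and> d = p ^ j * m \<and> N = p ^ (e + 2 * j) * m\<^sup>2"
    if d: "d \<in> D" for d
  proof -
    obtain p e where pe: "prime p" "N div d\<^sup>2 = p ^ e" "d\<^sup>2 dvd N"
      using d unfolding D_def primepow_def by blast
    then have N: "N = p ^ e * d\<^sup>2" by (metis dvd_div_mult_self)
    have "odd e"
    proof
      assume "even e"
      then have "N = (p ^ (e div 2) * d)\<^sup>2" by (simp add: N power_mult_distrib flip: power_mult)
      then show False using nonsquare by metis
    qed
    have "d \<noteq> 0" using nonsquare N by (metis mult_zero_right power_zero_numeral)
    then obtain m where m: "d = p ^ multiplicity p d * m" "\<not> p dvd m"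
      by (rule multiplicity_decompose'[of d p]) (use pe(1) in auto)
    define j where "j = multiplicity p d"
    have d: "d = p ^ j * m" using m(1) unfolding j_def .
    have "N = p ^ (e + 2 * j) * m\<^sup>2"
      unfolding N d by (simp only: power_add power_even_eq power_mult_distrib mult.assoc)
    then show ?thesis using pe(1) d m(2) \<open>odd e\<close> by blast
  qed
  \<comment> \<open>By uniqueness of the decomposition, the elements of \<open>D\<close> are exactly
    \<open>p ^ j * m\<close> with \<open>j \<le> g\<close>; the cofactor is then \<open>p\<close> to
    the odd power \<open>2 * (g - j) + 1\<close>, never 1.\<close>
  have card_D: "card D = Suc g" if N: "prime p" "\<not> p dvd m" "N = p ^ (2 * g + 1) * m\<^sup>2" for p m g
  proof -
    have "p > 1" using N(1) by (rule prime_gt_1_nat)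
    have "m > 0" using N(2) by (auto intro: gr0I)
    have "D = (\<lambda>j. p ^ j * m) ` {..g}"
    proof (intro equalityI subsetI)
      fix d assume "d \<in> D"
      then obtain q e j k where *: "prime q" "odd e" "\<not> q dvd k" "d = q ^ j * k" "N = q ^ (e + 2 * j) * k\<^sup>2"
        using decomp by blast
      have "p = q \<and> 2 * g + 1 = e + 2 * j \<and> m = k"
        using N * by (intro odd_prime_power_times_square_unique) auto
      moreover from this have "j \<le> g" using \<open>odd e\<close> by presburger
      ultimately show "d \<in> (\<lambda>j. p ^ j * m) ` {..g}" using *(4) by auto
    next
      fix d assume "d \<in> (\<lambda>j. p ^ j * m) ` {..g}"
      then obtain j where j: "j \<le> g" "d = p ^ j * m" by auto
      have "2 * g + 1 = (2 * (g - j) + 1) + 2 * j" using j by simp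
      then have "p ^ (2 * g + 1) = p ^ (2 * (g - j) + 1) * (p ^ j)\<^sup>2"
        by (metis power_add power_even_eq)
      then have "N = p ^ (2 * (g - j) + 1) * d\<^sup>2"
        unfolding N(3) j(2) by (simp only: power_mult_distrib mult.assoc)
      moreover have "d > 0" using j \<open>p > 1\<close> \<open>m > 0\<close> by simp
      ultimately have "N div d\<^sup>2 = p ^ (2 * (g - j) + 1)" "d\<^sup>2 dvd N" by simp_all
      then show "d \<in> D" using N(1) by (simp add: D_def del: power_Suc)
    qed
    moreover have "inj_on (\<lambda>j. p ^ j * m) {..g}"
      using \<open>p > 1\<close> \<open>m > 0\<close> by (auto simp: inj_on_def)
    ultimately show ?thesis by (simp add: card_image)
  qed
  have "odd (card D) \<longleftrightarrow> (\<exists>p m a. prime p \<and> m > 0 \<and> \<not> p dvd m \<and> N = p ^ (4 * a + 1) * m\<^sup>2)"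
  proof
    assume odd: "odd (card D)"
    then have "D \<noteq> {}" by auto
    then obtain p e j m where *: "prime p" "odd e" "\<not> p dvd m" "N = p ^ (e + 2 * j) * m\<^sup>2"
      using decomp by blast
    obtain i where i: "e = 2 * i + 1" using \<open>odd e\<close> by (elim oddE)
    have N: "N = p ^ (2 * (i + j) + 1) * m\<^sup>2" using *(4) i by (simp add: algebra_simps)
    have "even (i + j)" using card_D[OF *(1,3) N] odd by simp
    then obtain a where "i + j = 2 * a" by (elim evenE)
    then have "N = p ^ (4 * a + 1) * m\<^sup>2" using N by simp
    moreover have "m > 0" using *(3) by (auto intro: gr0I)
    ultimately show "\<exists>p m a. prime p \<and> m > 0 \<and> \<not> p dvd m \<and> N = p ^ (4 * a + 1) * m\<^sup>2"
      using * by blast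
  next
    assume "\<exists>p m a. prime p \<and> m > 0 \<and> \<not> p dvd m \<and> N = p ^ (4 * a + 1) * m\<^sup>2"
    then obtain p m a where *: "prime p" "\<not> p dvd m" "N = p ^ (4 * a + 1) * m\<^sup>2" by blast
    then have "N = p ^ (2 * (2 * a) + 1) * m\<^sup>2" by simp
    from card_D[OF *(1,2) this] show "odd (card D)" by simp
  qed
  then show ?thesis by (simp add: D_def)
qed

theorem theorem1p1:
  fixes n :: nat
  assumes "n > 0"
  shows "odd (num_regular_partitions 8 n) \<longleftrightarrow>
    (\<exists>p m a :: nat. prime p \<and> m > 0 \<and> \<not> p dvd m \<and> 24 * n + 7 = p ^ (4 * a + 1) * m ^ 2)"
proof -
  have N: "(24 * n + 7) mod 24 = 7" by presburger
  have "odd (num_regular_partitions 8 n) \<longleftrightarrow>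
      odd (card {(u::nat, v::nat). u\<^sup>2 + 3 * v\<^sup>2 = 24 * n + 7})"
    using num_regular_partitions_8_parity[OF assms] by (simp only: card_pentagonal_triangle)
  also have "\<dots> \<longleftrightarrow> odd (card {d. d\<^sup>2 dvd 24 * n + 7 \<and> primepow ((24 * n + 7) div d\<^sup>2)})"
    by (rule odd_card_form_reps_iff[OF N])
  also have "\<dots> \<longleftrightarrow> (\<exists>p m a. prime p \<and> m > 0 \<and> \<not> p dvd m \<and> 24 * n + 7 = p ^ (4 * a + 1) * m\<^sup>2)"
    using not_square_mod_24[OF N] by (intro odd_card_primepow_cofactors_iff) blast
  finally show ?thesis .
qed

end
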